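(* For every $p\in(2,\infty)$ there exists $\alpha_p\in(0,\infty)$ such that for every $q\in(2,p)$ and every $m,n\in\mathbb N$, $$c_p\big([m]_q^n\big)\ge C\,\alpha_p\left(\min\Big\{m^{\frac{q(p-2)}{q(p-2)+p-q}},\,n\Big\}\right)^{\frac{(p-q)(q-2)}{q^2(p-2)}},$$ where $C\in(0,\infty)$ is a universal constant. In particular, if $m\ge n^{1+\frac{p-q}{q(p-2)}}$ then $c_p([m]_q^n)\ge\alpha_p\,n^{\frac{(p-q)(q-2)}{q^2(p-2)}}$.
   Context: $[m]_q^n$ denotes the integer grid $\{0,\ldots,m\}^n\subset\mathbb R^n$ equipped with the metric inherited from $\ell_q^n$. For a metric space $X$, $c_p(X)$ is the infimum of $D\ge1$ such that there exist $s>0$ and $f:X\to L_p=L_p([0,1])$ with $s\,d_X(x,y)\le\|f(x)-f(y)\|_p\le Ds\,d_X(x,y)$ for all $x,y$ (and $c_p(X)=\infty$ if no such $D$ exists). *)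

theory Defs
  imports "HOL-Analysis.Analysis"
begin

text \<open>Elements of L_p([0,1]) represented by (Borel measurable, p-integrable) functions
  real \<Rightarrow> real; only their values on [0,1] matter.\<close>
definition Lp01_mem :: "real \<Rightarrow> (real \<Rightarrow> real) \<Rightarrow> bool" where
  "Lp01_mem p g \<longleftrightarrow> g \<in> borel_measurable lborel \<and>
     set_integrable lborel {0..1} (\<lambda>t. \<bar>g t\<bar> powr p)"

definition Lp01_dist :: "real \<Rightarrow> (real \<Rightarrow> real) \<Rightarrow> (real \<Rightarrow> real) \<Rightarrow> real" where
  "Lp01_dist p g h = (LINT t:{0..1}|lborel. \<bar>g t - h t\<bar> powr p) powr (1 / p)"

text \<open>The L_p distortion c_p(X) of a metric space (X,d); \<infinity> if no bi-Lipschitz embedding exists.\<close>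
definition c_p :: "real \<Rightarrow> 'a set \<Rightarrow> ('a \<Rightarrow> 'a \<Rightarrow> real) \<Rightarrow> ereal" where
  "c_p p X d = Inf {ereal D | D. D \<ge> 1 \<and>
     (\<exists>s>0. \<exists>f :: 'a \<Rightarrow> real \<Rightarrow> real. (\<forall>x\<in>X. Lp01_mem p (f x)) \<and>
        (\<forall>x\<in>X. \<forall>y\<in>X. s * d x y \<le> Lp01_dist p (f x) (f y) \<and>
                        Lp01_dist p (f x) (f y) \<le> D * s * d x y))}"

definition grid :: "nat \<Rightarrow> nat \<Rightarrow> (nat \<Rightarrow> nat) set" where
  "grid m n = {x. (\<forall>i<n. x i \<le> m) \<and> (\<forall>i\<ge>n. x i = 0)}"

definition lq_dist :: "real \<Rightarrow> nat \<Rightarrow> (nat \<Rightarrow> nat) \<Rightarrow> (nat \<Rightarrow> nat) \<Rightarrow> real" where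
  "lq_dist q n x y = (\<Sum>i<n. \<bar>real (x i) - real (y i)\<bar> powr q) powr (1 / q)"

end

theory Submission
  imports Defs "HOL-Library.Function_Algebras"
begin

text \<open>
  The lower bound follows from a metric \<open>X\<^sub>p\<close> inequality in the style of Naor and Schechtman.
  Since the \<open>p\<close>-th power of the \<open>L\<^sub>p\<close> distance is an integral, it suffices to treat real-valued
  functions \<open>f\<close> on a discrete torus. For a random sign vector \<open>\<epsilon>\<close> and a random set \<open>S\<close> of coordinates
  of density \<open>\<theta>\<close>, one bounds the \<open>p\<close>-th moment of \<open>f (x + 2 M \<epsilon>\<^sub>S) - f x\<close> by \<open>M\<^sup>p\<close> times
  \<open>\<theta>\<close> times the sum of the moments along single edges, plus \<open>\<theta>\<^bsup>p/2\<^esup>\<close> times the moment along a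
  random diagonal. To this end \<open>f\<close> is replaced by its average \<open>g\<close> over a cube of side about \<open>n\<close>;
  the increment of \<open>g\<close> along coordinate \<open>i\<close> then hardly depends on the other signs, so that
  \<open>g (x + \<epsilon>) - g (x + \<epsilon> - 2 \<epsilon>\<^sub>S)\<close> is nearly a Rademacher sum over \<open>S\<close>, to which Rosenthal's
  inequality and Bessel's inequality apply. Folding the torus onto the grid and taking
  \<open>\<theta> = n\<^bsup>-2(p-q)/(q(p-2))\<^esup>\<close>, which balances the two terms, gives the theorem.
\<close>

section \<open>Averages and moment inequalities\<close>

text \<open>Flipping the signs on S changes f by a signed sum of coordinate increments, but each
  increment depends on the other signs, so no moment inequality for independent signs applies to it.
  Smoothing with radius R divides this dependence by R + 1, at the price of an error R^p times the
  diagonal moment. Accumulated over S the dependence costs (|S| / R)^p, about \<theta>^p for R = n,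
  which \<theta>^(p/2) absorbs; the error n^p is absorbed by M^p \<theta>^(p/2) when M >= n / sqrt
  \<theta>. For the balancing \<theta> this is the threshold n^(1 + (p-q)/(q(p-2))) of the theorem.
  After folding, edges have length at most 1, diagonals at most n^(1/q), and the shift by 2 M
  \<epsilon>_S has length of order M |S|^(1/q) on average. The inequality becomes (\<theta> n)^(p/q)
  <= const D^p (\<theta> n + \<theta>^(p/2) n^(p/q)). Equality of the last two terms determines
  \<theta>, and a p-th root gives the exponent. If the grid is too short for n, fewer coordinates
  are used.\<close>

definition avg :: "'a set \<Rightarrow> ('a \<Rightarrow> real) \<Rightarrow> real" where
  "avg A F = sum F A / real (card A)"

lemma avg_mono: "(\<And>x. x \<in> A \<Longrightarrow> F x \<le> G x) \<Longrightarrow> avg A F \<le> avg A G"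
  unfolding avg_def by (intro divide_right_mono sum_mono) auto

lemma avg_nonneg: "(\<And>x. x \<in> A \<Longrightarrow> 0 \<le> F x) \<Longrightarrow> 0 \<le> avg A F"
  unfolding avg_def by (intro divide_nonneg_nonneg sum_nonneg) auto

lemma avg_cong: "(\<And>x. x \<in> A \<Longrightarrow> F x = G x) \<Longrightarrow> avg A F = avg A G"
  unfolding avg_def by (metis sum.cong)

lemma avg_add: "avg A (\<lambda>x. F x + G x) = avg A F + avg A G"
  unfolding avg_def by (simp add: sum.distrib add_divide_distrib)

lemma avg_diff: "avg A (\<lambda>x. F x - G x) = avg A F - avg A G"
  unfolding avg_def by (simp add: sum_subtractf diff_divide_distrib)

lemma avg_cmult: "avg A (\<lambda>x. c * F x) = c * avg A F"
  unfolding avg_def by (simp add: sum_distrib_left)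

lemma avg_sum: "avg A (\<lambda>x. \<Sum>i\<in>B. F i x) = (\<Sum>i\<in>B. avg A (F i))"
  unfolding avg_def by (subst sum.swap) (simp add: sum_divide_distrib)

text \<open>The excluded cases, A empty or infinite, are those where \<open>avg\<close> takes the
  default value 0; the linear rules above survive them.\<close>

lemma avg_const: "finite A \<Longrightarrow> A \<noteq> {} \<Longrightarrow> avg A (\<lambda>x. c) = c"
  unfolding avg_def by simp

lemma avg_swap: "avg A (\<lambda>x. avg B (F x)) = avg B (\<lambda>y. avg A (\<lambda>x. F x y))"
  unfolding avg_def by (subst sum_divide_distrib[symmetric], subst sum.swap)
    (simp add: sum_divide_distrib[symmetric] mult.commute)

lemma avg_reindex: "bij_betw h A A \<Longrightarrow> avg A (\<lambda>x. F (h x)) = avg A F"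
  unfolding avg_def by (simp add: sum.reindex_bij_betw)

lemma avg_abs_le: "\<bar>avg A F\<bar> \<le> avg A (\<lambda>x. \<bar>F x\<bar>)"
  unfolding avg_def by (simp add: abs_divide divide_right_mono)

text \<open>By convexity the power function lies above its tangent at v; Young's inequality covers v
  = 0 as well. Averaged with v the mean, this is Jensen's inequality.\<close>

lemma powr_tangent:
  fixes u v p :: real
  assumes "p > 1" "u \<ge> 0" "v \<ge> 0"
  shows "p * u * v powr (p - 1) - (p - 1) * v powr p \<le> u powr p"
proof -
  have "u * v powr (p - 1) \<le> u powr p / p + (v powr (p - 1)) powr (p / (p - 1)) / (p / (p - 1))"
    using assms by (intro Youngs_inequality) (auto simp: field_simps)
  also have "(v powr (p - 1)) powr (p / (p - 1)) = v powr p"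
    using assms by (simp add: powr_powr)
  finally show ?thesis
    using assms by (simp add: field_simps)
qed

lemma avg_powr_le:
  fixes p :: real
  assumes "p > 1" "finite A" "A \<noteq> {}" "\<And>x. x \<in> A \<Longrightarrow> 0 \<le> F x"
  shows "avg A F powr p \<le> avg A (\<lambda>x. F x powr p)"
proof -
  define v where "v = avg A F"
  have v: "v \<ge> 0" unfolding v_def by (intro avg_nonneg assms)
  \<comment> \<open>The tangent at v evaluated at v itself. The value v = 0 is separate because
    splitting the power divides by v.\<close>
  have "v powr p = p * v powr (p - 1) * v - (p - 1) * v powr p"
  proof (cases "v = 0")
    case False
    with v have "v powr (p - 1) * v = v powr p"
      by (simp add: powr_diff)
    then show ?thesis by (simp add: algebra_simps)
  qed (use assms in auto)
  also have "\<dots> = avg A (\<lambda>x. p * v powr (p - 1) * F x - (p - 1) * v powr p)"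
    using assms by (subst avg_diff, subst avg_cmult) (simp add: avg_const v_def)
  also have "\<dots> \<le> avg A (\<lambda>x. F x powr p)"
    using powr_tangent[OF assms(1) assms(4) v] by (intro avg_mono) (simp add: algebra_simps)
  finally show ?thesis by (simp add: v_def)
qed

lemma avg_abs_powr_le:
  fixes p :: real
  assumes "p > 1" "finite A" "A \<noteq> {}"
  shows "\<bar>avg A F\<bar> powr p \<le> avg A (\<lambda>x. \<bar>F x\<bar> powr p)"
  using avg_powr_le[OF assms, of "\<lambda>x. \<bar>F x\<bar>"] avg_abs_le[of A F] assms(1)
  by (meson abs_ge_zero dual_order.trans less_eq_real_def powr_mono2 zero_less_one less_trans)

text \<open>Jensen's inequality for the uniform mean; of the normalisation, card A ^ p / card A
  remains.\<close>

lemma sum_abs_powr_le: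
  fixes p :: real
  assumes "p > 1"
  shows "\<bar>\<Sum>i\<in>A. u i\<bar> powr p \<le> real (card A) powr (p - 1) * (\<Sum>i\<in>A. \<bar>u i\<bar> powr p)"
proof (cases "finite A \<and> A \<noteq> {}")
  case True
  then have c: "real (card A) > 0" by (simp add: card_gt_0_iff)
  have "\<bar>\<Sum>i\<in>A. u i\<bar> powr p = (real (card A) * \<bar>avg A u\<bar>) powr p"
    using c by (simp add: avg_def abs_divide)
  also have "\<dots> = real (card A) powr p * \<bar>avg A u\<bar> powr p"
    by (simp add: powr_mult)
  also have "\<dots> \<le> real (card A) powr p * avg A (\<lambda>i. \<bar>u i\<bar> powr p)"
    using avg_abs_powr_le[OF assms] True by (intro mult_left_mono) auto
  also have "\<dots> = real (card A) powr (p - 1) * (\<Sum>i\<in>A. \<bar>u i\<bar> powr p)"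
    using c by (simp add: avg_def powr_diff)
  finally show ?thesis .
qed (use assms in auto)

lemma abs_add_powr_le:
  fixes p x y :: real
  assumes "p > 1"
  shows "\<bar>x + y\<bar> powr p \<le> 2 powr p * (\<bar>x\<bar> powr p + \<bar>y\<bar> powr p)"
proof -
  have "\<bar>x + y\<bar> powr p \<le> 2 powr (p - 1) * (\<bar>x\<bar> powr p + \<bar>y\<bar> powr p)"
    using sum_abs_powr_le[OF assms, of "\<lambda>b. if b then x else y" UNIV] by (simp add: UNIV_bool add.commute)
  also have "\<dots> \<le> 2 powr p * (\<bar>x\<bar> powr p + \<bar>y\<bar> powr p)"
    by (intro mult_right_mono powr_mono) auto
  finally show ?thesis .
qed

lemma abs_diff_powr_le:
  fixes p x y :: real
  assumes "p > 1"
  shows "\<bar>x - y\<bar> powr p \<le> 2 powr p * (\<bar>x\<bar> powr p + \<bar>y\<bar> powr p)"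
  using abs_add_powr_le[OF assms, of x "- y"] by simp

lemma abs_add3_powr_le:
  fixes p x y z :: real
  assumes "p > 1"
  shows "\<bar>x + y + z\<bar> powr p \<le> 4 powr p * (\<bar>x\<bar> powr p + \<bar>y\<bar> powr p + \<bar>z\<bar> powr p)"
proof -
  have "\<bar>x + y + z\<bar> powr p \<le> 2 powr p * (\<bar>x + y\<bar> powr p + \<bar>z\<bar> powr p)"
    by (rule abs_add_powr_le[OF assms])
  also have "\<dots> \<le> 2 powr p * (2 powr p * (\<bar>x\<bar> powr p + \<bar>y\<bar> powr p) + 2 powr p * \<bar>z\<bar> powr p)"
    using assms mult_right_mono[of 1 "2 powr p" "\<bar>z\<bar> powr p"]
    by (intro mult_left_mono add_mono abs_add_powr_le) (auto simp: ge_one_powr_ge_zero)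
  also have "\<dots> = (2 * 2) powr p * (\<bar>x\<bar> powr p + \<bar>y\<bar> powr p + \<bar>z\<bar> powr p)"
    by (subst powr_mult) (simp_all add: algebra_simps)
  finally show ?thesis by simp
qed

section \<open>The two-point inequality\<close>

lemma cosh_bound:
  fixes u :: real
  assumes "u \<ge> 0"
  shows "(exp u + exp (- u)) / 2 \<le> 1 + u\<^sup>2 * exp u"
proof -
  \<comment> \<open>With this w, cosh u - 1 = (w - 1/w)^2 / 2, and w - 1/w <= u w follows from 1 - u
    <= exp (- u).\<close>
  define w where "w = exp (u / 2)"
  have w: "w > 0" "exp u = w\<^sup>2" "exp (- u) = 1 / w\<^sup>2"
    by (auto simp: w_def power2_eq_square exp_minus field_simps simp flip: exp_add)
  have "1 - u \<le> exp (- u)" using exp_ge_add_one_self[of "-u"] by simp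
  then have a: "w\<^sup>2 - 1 \<le> u * w\<^sup>2" using w by (simp add: field_simps)
  have "w \<ge> 1" using assms by (simp add: w_def)
  then have "(w\<^sup>2 - 1)\<^sup>2 \<le> (u * w\<^sup>2)\<^sup>2"
    using a by (intro power_mono) auto
  also have "\<dots> \<le> 2 * (u * w\<^sup>2)\<^sup>2" by simp
  finally have "w^4 + 1 \<le> 2 * w\<^sup>2 + 2 * u\<^sup>2 * w^4"
    by (simp add: power2_diff power_mult_distrib algebra_simps)
  then show ?thesis
    using w(1) unfolding w(2,3) by (simp add: field_simps)
qed

text \<open>2^p serves the range a >= s of the two-point inequality, p^2 exp p the range a <
  s.\<close>

definition two_point_const :: "real \<Rightarrow> real" where "two_point_const p = 2 powr p + p\<^sup>2 * exp p"

text \<open>The terms linear in a cancel in the symmetric mean. What remains is the second-order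
  term s^(p-2) a^2 when a is small against s, and a^p when it is not.\<close>

lemma two_point_bound_nonneg:
  fixes s a p :: real
  assumes p: "p > 2" and "s \<ge> 0" "a \<ge> 0"
  shows "(\<bar>s + a\<bar> powr p + \<bar>s - a\<bar> powr p) / 2
    \<le> s powr p + two_point_const p * (s powr (p - 2) * a\<^sup>2 + a powr p)"
proof (cases "a < s")
  case False
  have "\<bar>s + a\<bar> powr p \<le> (2 * a) powr p" "\<bar>s - a\<bar> powr p \<le> (2 * a) powr p"
    using False assms by (auto intro!: powr_mono2)
  then have "(\<bar>s + a\<bar> powr p + \<bar>s - a\<bar> powr p) / 2 \<le> 2 powr p * a powr p"
    using assms by (simp add: powr_mult)
  also have "\<dots> \<le> two_point_const p * (s powr (p - 2) * a\<^sup>2 + a powr p)"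
    unfolding two_point_const_def by (intro mult_mono) auto
  also have "\<dots> \<le> s powr p + \<dots>" by simp
  finally show ?thesis .
next
  case True
  then have s: "s > 0" using assms by simp
  define t where "t = a / s"
  have t: "0 \<le> t" "t < 1" and a: "a = t * s" using s True assms by (auto simp: t_def)
  have e: "(1 + t) powr p \<le> exp (p * t)"
  proof -
    have "(1 + t) powr p \<le> exp t powr p" using t p by (intro powr_mono2) auto
    then show ?thesis by (simp add: powr_def mult.commute)
  qed
  have e': "(1 - t) powr p \<le> exp (- (p * t))"
  proof -
    have "(1 - t) powr p \<le> exp (- t) powr p" using t p exp_ge_add_one_self[of "-t"] by (intro powr_mono2) auto
    then show ?thesis by (simp add: powr_def mult.commute)
  qed
  \<comment> \<open>Bounding both factors by exponentials of opposite exponents gives a hyperbolic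
    cosine, so the cancellation of the linear terms is kept.\<close>
  have "((1 + t) powr p + (1 - t) powr p) / 2 \<le> (exp (p * t) + exp (- (p * t))) / 2"
    using e e' by simp
  also have "\<dots> \<le> 1 + (p * t)\<^sup>2 * exp (p * t)" using t p by (intro cosh_bound) auto
  also have "\<dots> \<le> 1 + (p * t)\<^sup>2 * exp p" using t p by (intro add_left_mono mult_left_mono) auto
  also have "\<dots> = 1 + (p\<^sup>2 * exp p) * t\<^sup>2" by (simp add: power_mult_distrib)
  also have "\<dots> \<le> 1 + two_point_const p * t\<^sup>2" unfolding two_point_const_def by (intro add_left_mono mult_right_mono) auto
  finally have f: "((1 + t) powr p + (1 - t) powr p) / 2 \<le> 1 + two_point_const p * t\<^sup>2" .
  have "\<bar>s + a\<bar> = (1 + t) * s" "\<bar>s - a\<bar> = (1 - t) * s"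
    using a t s True by (auto simp: algebra_simps)
  then have "\<bar>s + a\<bar> powr p = (1 + t) powr p * s powr p" "\<bar>s - a\<bar> powr p = (1 - t) powr p * s powr p"
    using t s by (simp_all add: powr_mult)
  then have "(\<bar>s + a\<bar> powr p + \<bar>s - a\<bar> powr p) / 2 = ((1 + t) powr p + (1 - t) powr p) / 2 * s powr p"
    by (simp add: algebra_simps)
  also have "\<dots> \<le> (1 + two_point_const p * t\<^sup>2) * s powr p" using f by (intro mult_right_mono) auto
  also have "\<dots> = s powr p + two_point_const p * (s powr (p - 2) * a\<^sup>2)"
  proof -
    have "s powr p = s powr (p - 2) * s\<^sup>2" using s by (simp add: powr_diff)
    then show ?thesis by (simp add: a power_mult_distrib algebra_simps)
  qed
  also have "\<dots> \<le> s powr p + two_point_const p * (s powr (p - 2) * a\<^sup>2 + a powr p)"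
    by (intro add_left_mono mult_left_mono) (auto simp: two_point_const_def)
  finally show ?thesis .
qed

text \<open>A change of sign of s or a only exchanges the two summands on the left.\<close>

lemma two_point_bound:
  fixes s a p :: real
  assumes p: "p > 2"
  shows "(\<bar>s + a\<bar> powr p + \<bar>s - a\<bar> powr p) / 2
    \<le> \<bar>s\<bar> powr p + two_point_const p * (\<bar>s\<bar> powr (p - 2) * a\<^sup>2 + \<bar>a\<bar> powr p)"
proof -
  have "\<bar>s + a\<bar> powr p + \<bar>s - a\<bar> powr p = \<bar>\<bar>s\<bar> + \<bar>a\<bar>\<bar> powr p + \<bar>\<bar>s\<bar> - \<bar>a\<bar>\<bar> powr p"
  proof -
    have "(\<bar>s + a\<bar> = \<bar>\<bar>s\<bar> + \<bar>a\<bar>\<bar> \<and> \<bar>s - a\<bar> = \<bar>\<bar>s\<bar> - \<bar>a\<bar>\<bar>) \<or>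
        (\<bar>s + a\<bar> = \<bar>\<bar>s\<bar> - \<bar>a\<bar>\<bar> \<and> \<bar>s - a\<bar> = \<bar>\<bar>s\<bar> + \<bar>a\<bar>\<bar>)"
      by linarith
    then show ?thesis by auto
  qed
  then show ?thesis using two_point_bound_nonneg[OF p, of "\<bar>s\<bar>" "\<bar>a\<bar>"] by simp
qed

section \<open>Signs and random subsets\<close>

text \<open>Vectors indexed by I, extended by 0 so that each is a single total function. The entries
  will be signs, residues of the torus, or points of the smoothing interval.\<close>

definition cube :: "'i set \<Rightarrow> int set \<Rightarrow> ('i \<Rightarrow> int) set" where
  "cube I V = {x. (\<forall>i\<in>I. x i \<in> V) \<and> (\<forall>i. i \<notin> I \<longrightarrow> x i = 0)}"

lemma cube_empty [simp]: "cube {} V = {0}"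
  by (auto simp: cube_def fun_eq_iff)

lemma cube_insert:
  assumes "i \<notin> I"
  shows "cube (insert i I) V = (\<lambda>(v, x). x(i := v)) ` (V \<times> cube I V)"
proof (intro equalityI subsetI)
  fix x assume x: "x \<in> cube (insert i I) V"
  have "x = (x(i := 0))(i := x i)" by simp
  moreover have "(x i, x(i := 0)) \<in> V \<times> cube I V" using x assms by (auto simp: cube_def)
  ultimately show "x \<in> (\<lambda>(v, x). x(i := v)) ` (V \<times> cube I V)" by (metis (no_types, lifting) case_prod_conv image_eqI)
qed (use assms in \<open>auto simp: cube_def\<close>)

lemma finite_cube [simp]: "finite I \<Longrightarrow> finite V \<Longrightarrow> finite (cube I V)"
  by (induction I rule: finite_induct) (simp_all add: cube_insert)

lemma cube_nonempty [simp]: "V \<noteq> {} \<Longrightarrow> cube I V \<noteq> {}"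
proof -
  assume "V \<noteq> {}"
  then obtain v where "v \<in> V" by blast
  then have "(\<lambda>i. if i \<in> I then v else 0) \<in> cube I V" by (simp add: cube_def)
  then show ?thesis by blast
qed

lemma sum_cube_insert:
  assumes "i \<notin> I"
  shows "sum F (cube (insert i I) V) = (\<Sum>v\<in>V. \<Sum>x\<in>cube I V. F (x(i := v)))"
proof -
  have "inj_on (\<lambda>(v, x). x(i := v)) (V \<times> cube I V)"
  proof (rule inj_onI, clarify)
    fix v w x y assume "x \<in> cube I V" "y \<in> cube I V" and e: "x(i := v) = y(i := w)"
    then have "x i = 0" "y i = 0" using assms by (auto simp: cube_def)
    with e show "v = w \<and> x = y" by (metis fun_upd_same fun_upd_triv fun_upd_upd)
  qed
  then show ?thesis
    using assms by (simp add: cube_insert sum.reindex sum.cartesian_product case_prod_unfold comp_def)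
qed

lemma avg_cube_insert:
  assumes "i \<notin> I"
  shows "avg (cube (insert i I) V) F = avg V (\<lambda>v. avg (cube I V) (\<lambda>x. F (x(i := v))))"
proof -
  have "card (cube (insert i I) V) = card V * card (cube I V)"
    using sum_cube_insert[OF assms, of "\<lambda>_. 1::nat" V] by simp
  then show ?thesis
    unfolding avg_def by (simp add: sum_cube_insert[OF assms] sum_divide_distrib[symmetric])
qed

text \<open>Fubini in one coordinate: overwriting x i by an independent uniform value does not
  change the distribution of x.\<close>

lemma avg_cube_resample:
  assumes "finite V" "V \<noteq> {}" "i \<in> I"
  shows "avg (cube I V) (\<lambda>x. avg V (\<lambda>v. F (x(i := v)))) = avg (cube I V) F"
proof -
  obtain J where J: "I = insert i J" "i \<notin> J" using assms(3) by (metis mk_disjoint_insert)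
  show ?thesis
    unfolding J(1) avg_cube_insert[OF J(2)]
    using assms by (simp add: avg_const avg_swap[of "cube J V"])
qed

abbreviation signs :: "'i set \<Rightarrow> ('i \<Rightarrow> int) set" where "signs I \<equiv> cube I {-1, 1}"

lemma avg_sign: "avg {-1, 1} F = (F 1 + F (-1)) / 2" for F :: "int \<Rightarrow> real"
  by (simp add: avg_def)

lemma signsD: "x \<in> signs I \<Longrightarrow> i \<in> I \<Longrightarrow> x i = -1 \<or> x i = 1"
  by (auto simp: cube_def)

lemma signs_square: "x \<in> signs I \<Longrightarrow> i \<in> I \<Longrightarrow> x i * x i = 1"
  using signsD by fastforce

lemma avg_signs_resample:
  assumes "i \<in> I"
  shows "avg (signs I) (\<lambda>x. (F (x(i := 1)) + F (x(i := -1))) / 2) = avg (signs I) F"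
  using avg_cube_resample[of "{-1, 1}" i I F] assms by (simp add: avg_sign)

text \<open>The product is pointwise. On I the vector s squares to 1 and off I everything is 0, so
  multiplication by s is its own inverse on the cube.\<close>

lemma bij_cube_mult:
  assumes s: "s \<in> signs I" and V: "\<And>v. v \<in> V \<Longrightarrow> - v \<in> V"
  shows "bij_betw ((*) s) (cube I V) (cube I V)"
proof (rule bij_betwI[where g = "(*) s"])
  have 1: "s * x \<in> cube I V" if "x \<in> cube I V" for x
    unfolding cube_def
  proof (intro CollectI conjI ballI allI impI)
    fix i assume "i \<in> I"
    then have "x i \<in> V" using that by (simp add: cube_def)
    then show "(s * x) i \<in> V" using signsD[OF s \<open>i \<in> I\<close>] V by auto
  qed (use that s in \<open>auto simp: cube_def\<close>)
  then show "(*) s \<in> cube I V \<rightarrow> cube I V" "(*) s \<in> cube I V \<rightarrow> cube I V" by auto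
  have *: "s * (s * x) = x" if "x \<in> cube I V" for x
  proof
    fix i show "(s * (s * x)) i = x i"
      using that signs_square[OF s, of i]
      by (cases "i \<in> I") (simp_all flip: mult.assoc add: cube_def)
  qed
  then show "\<And>x. x \<in> cube I V \<Longrightarrow> s * (s * x) = x" "\<And>x. x \<in> cube I V \<Longrightarrow> s * (s * x) = x"
    by auto
qed

lemma avg_signs_mult: "s \<in> signs I \<Longrightarrow> avg (signs I) (\<lambda>x. F (s * x)) = avg (signs I) F"
  by (rule avg_reindex[OF bij_cube_mult]) auto

lemma avg_signs_coord:
  assumes "finite I" "i \<in> I"
  shows "avg (signs I) (\<lambda>x. F (x i)) = (F 1 + F (-1)) / 2"
  by (subst avg_signs_resample[OF assms(2), symmetric]) (use assms in \<open>simp add: avg_const\<close>)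

lemma signs_orthonormal:
  assumes "finite I" "i \<in> I" "j \<in> I"
  shows "avg (signs I) (\<lambda>d. real_of_int (d i) * real_of_int (d j)) = (if i = j then 1 else 0)"
proof (cases "i = j")
  case True
  then show ?thesis using avg_signs_coord[OF assms(1,2), of "\<lambda>d. real_of_int d * real_of_int d"] by simp
next
  case False
  then show ?thesis
    by (subst avg_signs_resample[OF assms(2), symmetric]) (use assms in \<open>simp add: avg_const\<close>)
qed

lemma signs_bessel:
  fixes \<phi> :: "('i \<Rightarrow> int) \<Rightarrow> real"
  assumes "finite I"
  shows "(\<Sum>i\<in>I. (avg (signs I) (\<lambda>d. real_of_int (d i) * \<phi> d))\<^sup>2) \<le> avg (signs I) (\<lambda>d. (\<phi> d)\<^sup>2)"
proof -
  define c where "c i = avg (signs I) (\<lambda>d. real_of_int (d i) * \<phi> d)" for i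
  \<comment> \<open>The squared distance from \<phi> to its orthogonal projection onto the span of
    the coordinate signs; expanding the square gives the claim.\<close>
  have "0 \<le> avg (signs I) (\<lambda>d. (\<phi> d - (\<Sum>i\<in>I. c i * real_of_int (d i)))\<^sup>2)"
    by (rule avg_nonneg) auto
  also have "(\<lambda>d. (\<phi> d - (\<Sum>i\<in>I. c i * real_of_int (d i)))\<^sup>2) =
      (\<lambda>d. (\<phi> d)\<^sup>2 - (\<Sum>i\<in>I. (2 * c i) * (real_of_int (d i) * \<phi> d))
         + (\<Sum>i\<in>I. \<Sum>j\<in>I. (c i * c j) * (real_of_int (d i) * real_of_int (d j))))"
  proof
    fix d
    have "(\<Sum>i\<in>I. c i * real_of_int (d i))\<^sup>2 = (\<Sum>i\<in>I. \<Sum>j\<in>I. (c i * c j) * (real_of_int (d i) * real_of_int (d j)))"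
      unfolding power2_eq_square sum_product by (simp add: mult_ac)
    moreover have "2 * \<phi> d * (\<Sum>i\<in>I. c i * real_of_int (d i)) = (\<Sum>i\<in>I. (2 * c i) * (real_of_int (d i) * \<phi> d))"
      by (simp add: sum_distrib_left mult_ac)
    ultimately show "(\<phi> d - (\<Sum>i\<in>I. c i * real_of_int (d i)))\<^sup>2 = (\<phi> d)\<^sup>2 - (\<Sum>i\<in>I. (2 * c i) * (real_of_int (d i) * \<phi> d))
         + (\<Sum>i\<in>I. \<Sum>j\<in>I. (c i * c j) * (real_of_int (d i) * real_of_int (d j)))"
      by (simp only: power2_diff)
  qed
  also have "avg (signs I) \<dots> = avg (signs I) (\<lambda>d. (\<phi> d)\<^sup>2) - (\<Sum>i\<in>I. (2 * c i) * c i)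
      + (\<Sum>i\<in>I. \<Sum>j\<in>I. (c i * c j) * (if i = j then 1 else 0))"
    using assms by (simp add: avg_add avg_diff avg_sum avg_cmult signs_orthonormal c_def cong: sum.cong)
  also have "\<dots> = avg (signs I) (\<lambda>d. (\<phi> d)\<^sup>2) - (\<Sum>i\<in>I. (c i)\<^sup>2)"
    using assms by (simp add: power2_eq_square sum_distrib_left[symmetric] mult.assoc if_distrib cong: if_cong)
  finally show ?thesis by (simp add: c_def)
qed

section \<open>Random subsets with independent inclusion probability \<theta>, and Rosenthal's
  inequality\<close>

definition bernoulli_avg :: "real \<Rightarrow> 'i set \<Rightarrow> ('i set \<Rightarrow> real) \<Rightarrow> real" where
  "bernoulli_avg \<theta> I F = (\<Sum>S\<in>Pow I. \<theta> ^ card S * (1 - \<theta>) ^ card (I - S) * F S)"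

lemma bernoulli_avg_empty [simp]: "bernoulli_avg \<theta> {} F = F {}"
  by (simp add: bernoulli_avg_def)

text \<open>Conditioning on whether i belongs to S; the recursion behind the inductions on
  I.\<close>

lemma bernoulli_avg_insert:
  assumes "finite I" "i \<notin> I"
  shows "bernoulli_avg \<theta> (insert i I) F = \<theta> * bernoulli_avg \<theta> I (\<lambda>S. F (insert i S)) + (1 - \<theta>) * bernoulli_avg \<theta> I F"
proof -
  have inj: "inj_on (insert i) (Pow I)" using assms by (auto simp: inj_on_def)
  have 1: "insert i I - S = insert i (I - S)" if "S \<subseteq> I" for S using that assms by auto
  have 2: "insert i I - insert i S = I - S" for S using assms by auto
  have fin: "finite S" "i \<notin> S" if "S \<subseteq> I" for S using that assms by (auto intro: finite_subset)
  have "bernoulli_avg \<theta> (insert i I) F = 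
     (\<Sum>S\<in>Pow I. \<theta> ^ card S * (1 - \<theta>) ^ card (insert i I - S) * F S) +
     (\<Sum>S\<in>Pow I. \<theta> ^ card (insert i S) * (1 - \<theta>) ^ card (insert i I - insert i S) * F (insert i S))"
    unfolding bernoulli_avg_def Pow_insert using assms
    by (subst sum.union_disjoint) (auto simp: sum.reindex[OF inj])
  also have "(\<Sum>S\<in>Pow I. \<theta> ^ card S * (1 - \<theta>) ^ card (insert i I - S) * F S) = (1 - \<theta>) * bernoulli_avg \<theta> I F"
    unfolding bernoulli_avg_def sum_distrib_left using assms by (intro sum.cong) (auto simp: 1)
  also have "(\<Sum>S\<in>Pow I. \<theta> ^ card (insert i S) * (1 - \<theta>) ^ card (insert i I - insert i S) * F (insert i S))
      = \<theta> * bernoulli_avg \<theta> I (\<lambda>S. F (insert i S))"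
    unfolding bernoulli_avg_def sum_distrib_left using fin by (intro sum.cong) (auto simp: 2)
  finally show ?thesis by simp
qed

lemma bernoulli_avg_mono:
  "0 \<le> \<theta> \<Longrightarrow> \<theta> \<le> 1 \<Longrightarrow> (\<And>S. S \<subseteq> I \<Longrightarrow> F S \<le> G S) \<Longrightarrow> bernoulli_avg \<theta> I F \<le> bernoulli_avg \<theta> I G"
  unfolding bernoulli_avg_def by (intro sum_mono mult_left_mono) auto

lemma bernoulli_avg_cong: "(\<And>S. S \<subseteq> I \<Longrightarrow> F S = G S) \<Longrightarrow> bernoulli_avg \<theta> I F = bernoulli_avg \<theta> I G"
  unfolding bernoulli_avg_def by (intro sum.cong) auto

lemma bernoulli_avg_add: "bernoulli_avg \<theta> I (\<lambda>S. F S + G S) = bernoulli_avg \<theta> I F + bernoulli_avg \<theta> I G"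
  unfolding bernoulli_avg_def by (simp add: sum.distrib algebra_simps)

lemma bernoulli_avg_cmult: "bernoulli_avg \<theta> I (\<lambda>S. c * F S) = c * bernoulli_avg \<theta> I F"
  unfolding bernoulli_avg_def by (simp add: sum_distrib_left mult_ac)

lemma bernoulli_avg_const: "finite I \<Longrightarrow> bernoulli_avg \<theta> I (\<lambda>S. c) = c"
  by (induction I rule: finite_induct) (simp_all add: bernoulli_avg_insert algebra_simps)

lemma bernoulli_avg_avg: "bernoulli_avg \<theta> I (\<lambda>S. avg A (F S)) = avg A (\<lambda>x. bernoulli_avg \<theta> I (\<lambda>S. F S x))"
  unfolding bernoulli_avg_def by (simp add: avg_sum avg_cmult)

lemma bernoulli_avg_sum_mem:
  assumes "finite I"
  shows "bernoulli_avg \<theta> I (\<lambda>S. \<Sum>i\<in>S. a i) = \<theta> * (\<Sum>i\<in>I. a i)"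
  using assms
proof (induction I rule: finite_induct)
  case (insert i I)
  have "bernoulli_avg \<theta> I (\<lambda>S. \<Sum>i\<in>insert i S. a i) = bernoulli_avg \<theta> I (\<lambda>S. a i + (\<Sum>i\<in>S. a i))"
    using insert by (intro bernoulli_avg_cong sum.insert) (auto intro: finite_subset)
  then show ?case
    using insert by (simp add: bernoulli_avg_insert bernoulli_avg_add bernoulli_avg_const algebra_simps)
qed auto

text \<open>The moment generating function of the binomial distribution of card S.\<close>

lemma bernoulli_avg_exp_card:
  assumes "finite I"
  shows "bernoulli_avg \<theta> I (\<lambda>S. exp (t * real (card S))) = (1 + \<theta> * (exp t - 1)) ^ card I"
  using assms
proof (induction I rule: finite_induct)
  case (insert i I)
  have "bernoulli_avg \<theta> I (\<lambda>S. exp (t * real (card (insert i S)))) = bernoulli_avg \<theta> I (\<lambda>S. exp t * exp (t * real (card S)))"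
  proof (intro bernoulli_avg_cong)
    fix S assume "S \<subseteq> I"
    then have "card (insert i S) = Suc (card S)" using insert by (auto intro: finite_subset card_insert_disjoint)
    then show "exp (t * real (card (insert i S))) = exp t * exp (t * real (card S))"
      by (simp add: algebra_simps exp_add)
  qed
  then show ?case
    using insert by (simp add: bernoulli_avg_insert bernoulli_avg_cmult algebra_simps)
qed auto

text \<open>The power is compared with an exponential of rate 1 / l, where l is the mean of card S.
  Since l >= 1, the exponential moment is at most exp 2 <= 9.\<close>

lemma bernoulli_avg_card_powr_le:
  fixes p \<theta> :: real
  assumes "finite I" "0 \<le> \<theta>" "\<theta> \<le> 1" "\<theta> * real (card I) \<ge> 1" "p > 0"
  shows "bernoulli_avg \<theta> I (\<lambda>S. real (card S) powr p) \<le> 9 * p powr p * (\<theta> * real (card I)) powr p"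
proof -
  define l where "l = \<theta> * real (card I)"
  have l: "l \<ge> 1" using assms by (simp add: l_def)
  \<comment> \<open>This is x / p <= exp (x / p), raised to the power p.\<close>
  have pw: "x powr p \<le> p powr p * exp x" if "x \<ge> 0" for x
  proof -
    have "x / p \<le> exp (x / p)" using exp_ge_add_one_self[of "x / p"] by linarith
    then have "(x / p) powr p \<le> exp (x / p) powr p" using that assms by (intro powr_mono2) auto
    also have "\<dots> = exp x" using assms by (simp add: powr_def)
    finally show ?thesis using that assms by (simp add: powr_divide field_simps)
  qed
  have "real (card S) powr p \<le> p powr p * l powr p * exp (1 / l * real (card S))" for S :: "'a set"
  proof -
    have "real (card S) powr p = l powr p * (1 / l * real (card S)) powr p"
      using l by (subst powr_mult[symmetric]) auto
    also have "\<dots> \<le> l powr p * (p powr p * exp (1 / l * real (card S)))"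
      using l by (intro mult_left_mono pw) auto
    finally show ?thesis by (simp add: mult_ac)
  qed
  then have "bernoulli_avg \<theta> I (\<lambda>S. real (card S) powr p)
     \<le> bernoulli_avg \<theta> I (\<lambda>S. p powr p * l powr p * exp (1 / l * real (card S)))"
    using assms by (intro bernoulli_avg_mono) auto
  also have "\<dots> = p powr p * l powr p * (1 + \<theta> * (exp (1 / l) - 1)) ^ card I"
    by (subst bernoulli_avg_cmult) (simp only: bernoulli_avg_exp_card[OF assms(1)])
  also have "\<dots> \<le> p powr p * l powr p * 9"
  proof (intro mult_left_mono)
    have "exp (1 / l) - 1 \<le> 2 / l"
    proof -
      have "exp (1 / l) \<le> 1 + 1 / l + (1 / l)\<^sup>2" using l by (intro exp_bound) auto
      moreover have "(1 / l)\<^sup>2 \<le> 1 / l" using l by (simp add: power2_eq_square field_simps)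
      ultimately show ?thesis by simp
    qed
    then have "1 + \<theta> * (exp (1 / l) - 1) \<le> 1 + \<theta> * (2 / l)"
      using assms by (intro add_left_mono mult_left_mono) auto
    also have "\<dots> \<le> exp (\<theta> * (2 / l))" by (rule exp_ge_add_one_self)
    finally have "(1 + \<theta> * (exp (1 / l) - 1)) ^ card I \<le> exp (\<theta> * (2 / l)) ^ card I"
      using assms l by (intro power_mono add_nonneg_nonneg mult_nonneg_nonneg) auto
    also have "\<dots> = exp (2 * (l / l))" by (simp add: l_def flip: exp_of_nat_mult)
    also have "\<dots> = exp 1 * exp (1::real)" using l by (simp flip: exp_add)
    also have "\<dots> \<le> 3 * 3" using exp_le by (intro mult_mono) auto
    finally show "(1 + \<theta> * (exp (1 / l) - 1)) ^ card I \<le> 9" by simp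
  qed auto
  finally show ?thesis by (simp add: l_def mult_ac)
qed

text \<open>Adding \<open>B powr p\<close> to the moment turns the two-point inequality, through
  \<open>\<bar>s\<bar>\<^bsup>p-2\<^esup> B\<^sup>2 \<le> \<bar>s\<bar>\<^sup>p + B\<^sup>p\<close>, into a linear recursion in the number of coordinates;
  \<open>B\<close> is later chosen to make the exponent equal to \<open>1\<close>.\<close>

lemma rosenthal_aux:
  fixes p \<theta> B :: real and a :: "'i \<Rightarrow> real"
  assumes p: "p > 2" and \<theta>: "0 \<le> \<theta>" "\<theta> \<le> 1" and B: "B > 0" and I: "finite I"
  shows "bernoulli_avg \<theta> I (\<lambda>S. avg (signs I) (\<lambda>\<epsilon>. \<bar>\<Sum>i\<in>S. real_of_int (\<epsilon> i) * a i\<bar> powr p)) + B powr p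
    \<le> exp (two_point_const p * \<theta> * (\<Sum>i\<in>I. (a i)\<^sup>2) / B\<^sup>2) * (B powr p + two_point_const p * \<theta> * (\<Sum>i\<in>I. \<bar>a i\<bar> powr p))"
  using I
proof (induction I rule: finite_induct)
  case empty
  then show ?case by (simp add: avg_const)
next
  case (insert j I)
  let ?K = "two_point_const p"
  let ?s = "\<lambda>S \<epsilon>. \<Sum>i\<in>S. real_of_int (\<epsilon> i) * a i"
  let ?u = "bernoulli_avg \<theta> I (\<lambda>S. avg (signs I) (\<lambda>\<epsilon>. \<bar>?s S \<epsilon>\<bar> powr p))"
  let ?E = "exp (?K * \<theta> * (\<Sum>i\<in>I. (a i)\<^sup>2) / B\<^sup>2)"
  let ?X = "B powr p + ?K * \<theta> * (\<Sum>i\<in>I. \<bar>a i\<bar> powr p)"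
  define c where "c = ?K * \<theta> * (a j)\<^sup>2 / B\<^sup>2"
  define d where "d = ?K * \<theta> * \<bar>a j\<bar> powr p"
  have K: "?K \<ge> 0" by (simp add: two_point_const_def)
  have c: "c \<ge> 0" and d: "d \<ge> 0" using K \<theta> by (auto simp: c_def d_def)
  have young: "\<bar>s\<bar> powr (p - 2) * (a j)\<^sup>2 \<le> (a j)\<^sup>2 / B\<^sup>2 * (\<bar>s\<bar> powr p + B powr p)" for s
  proof -
    have "\<bar>s\<bar> powr (p - 2) * B\<^sup>2 \<le> \<bar>s\<bar> powr p + B powr p"
    proof (cases "\<bar>s\<bar> \<le> B")
      case True
      then have "\<bar>s\<bar> powr (p - 2) * B\<^sup>2 \<le> B powr (p - 2) * B\<^sup>2"
        using p by (intro mult_right_mono powr_mono2) auto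
      also have "\<dots> = B powr p" using B by (simp add: powr_diff)
      finally show ?thesis by (simp add: add_increasing)
    next
      case False
      then have "\<bar>s\<bar> powr (p - 2) * B\<^sup>2 \<le> \<bar>s\<bar> powr (p - 2) * \<bar>s\<bar>\<^sup>2"
        using B by (intro mult_left_mono power_mono) auto
      also have "\<dots> = \<bar>s\<bar> powr p" using B False by (simp add: powr_diff)
      finally show ?thesis by (simp add: add_increasing2)
    qed
    then have "(\<bar>s\<bar> powr (p - 2) * B\<^sup>2) * ((a j)\<^sup>2 / B\<^sup>2) \<le> (\<bar>s\<bar> powr p + B powr p) * ((a j)\<^sup>2 / B\<^sup>2)"
      by (intro mult_right_mono) auto
    then show ?thesis using B by (simp add: mult_ac)
  qed
  have s1: "?s (insert j S) (\<epsilon>(j := v)) = v * a j + ?s S \<epsilon>" and s2: "?s S (\<epsilon>(j := v)) = ?s S \<epsilon>"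
    if "S \<subseteq> I" for S \<epsilon> v
  proof -
    have j: "j \<notin> S" "finite S" using that insert by (auto intro: finite_subset)
    then show s2: "?s S (\<epsilon>(j := v)) = ?s S \<epsilon>" by (intro sum.cong) auto
    have "?s (insert j S) (\<epsilon>(j := v)) = (\<epsilon>(j := v)) j * a j + ?s S (\<epsilon>(j := v))"
      using j by (intro sum.insert) auto
    then show "?s (insert j S) (\<epsilon>(j := v)) = v * a j + ?s S \<epsilon>"
      by (simp only: s2) simp
  qed
  \<comment> \<open>Condition on j: with probability \<theta> it joins S and its random sign
    contributes a j or - a j; otherwise the sum is unchanged.\<close>
  have "bernoulli_avg \<theta> (insert j I) (\<lambda>S. avg (signs (insert j I)) (\<lambda>\<epsilon>. \<bar>?s S \<epsilon>\<bar> powr p)) =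
     \<theta> * bernoulli_avg \<theta> I (\<lambda>S. avg (signs I) (\<lambda>\<epsilon>. (\<bar>?s S \<epsilon> + a j\<bar> powr p + \<bar>?s S \<epsilon> - a j\<bar> powr p) / 2))
     + (1 - \<theta>) * ?u"
  proof -
    have "bernoulli_avg \<theta> I (\<lambda>S. avg (signs (insert j I)) (\<lambda>\<epsilon>. \<bar>?s (insert j S) \<epsilon>\<bar> powr p)) =
      bernoulli_avg \<theta> I (\<lambda>S. avg (signs I) (\<lambda>\<epsilon>. (\<bar>?s S \<epsilon> + a j\<bar> powr p + \<bar>?s S \<epsilon> - a j\<bar> powr p) / 2))"
    proof (intro bernoulli_avg_cong)
      fix S assume S: "S \<subseteq> I"
      have "avg (signs (insert j I)) (\<lambda>\<epsilon>. \<bar>?s (insert j S) \<epsilon>\<bar> powr p) =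
         avg (signs I) (\<lambda>\<epsilon>. avg {-1, 1} (\<lambda>v. \<bar>real_of_int v * a j + ?s S \<epsilon>\<bar> powr p))"
        by (subst avg_cube_insert[OF insert(2)], subst avg_swap) (simp only: s1[OF S])
      also have "\<dots> = avg (signs I) (\<lambda>\<epsilon>. (\<bar>?s S \<epsilon> + a j\<bar> powr p + \<bar>?s S \<epsilon> - a j\<bar> powr p) / 2)"
        by (intro avg_cong) (simp add: avg_sign add.commute)
      finally show "avg (signs (insert j I)) (\<lambda>\<epsilon>. \<bar>?s (insert j S) \<epsilon>\<bar> powr p) = \<dots>" .
    qed
    moreover have "bernoulli_avg \<theta> I (\<lambda>S. avg (signs (insert j I)) (\<lambda>\<epsilon>. \<bar>?s S \<epsilon>\<bar> powr p)) = ?u"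
    proof (intro bernoulli_avg_cong)
      fix S assume S: "S \<subseteq> I"
      show "avg (signs (insert j I)) (\<lambda>\<epsilon>. \<bar>?s S \<epsilon>\<bar> powr p) = avg (signs I) (\<lambda>\<epsilon>. \<bar>?s S \<epsilon>\<bar> powr p)"
        by (subst avg_cube_insert[OF insert(2)]) (simp only: s2[OF S], simp add: avg_const)
    qed
    ultimately show ?thesis by (simp only: bernoulli_avg_insert[OF insert(1,2)])
  qed
  also have "\<dots> \<le> \<theta> * bernoulli_avg \<theta> I (\<lambda>S. avg (signs I) (\<lambda>\<epsilon>. \<bar>?s S \<epsilon>\<bar> powr p +
       ?K * ((a j)\<^sup>2 / B\<^sup>2 * (\<bar>?s S \<epsilon>\<bar> powr p + B powr p) + \<bar>a j\<bar> powr p))) + (1 - \<theta>) * ?u"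
    using \<theta> K by (intro add_right_mono mult_left_mono bernoulli_avg_mono avg_mono
      order_trans[OF two_point_bound[OF p]] add_left_mono young) auto
  also have "\<dots> = ?u + c * (?u + B powr p) + d"
  proof -
    have lin: "x + ?K * (e * (x + b) + q) = (1 + ?K * e) * x + (?K * e * b + ?K * q)" for x e b q
      by (simp add: algebra_simps)
    have "bernoulli_avg \<theta> I (\<lambda>S. avg (signs I) (\<lambda>\<epsilon>. \<bar>?s S \<epsilon>\<bar> powr p +
       ?K * ((a j)\<^sup>2 / B\<^sup>2 * (\<bar>?s S \<epsilon>\<bar> powr p + B powr p) + \<bar>a j\<bar> powr p)))
      = (1 + ?K * ((a j)\<^sup>2 / B\<^sup>2)) * ?u + (?K * ((a j)\<^sup>2 / B\<^sup>2) * B powr p + ?K * \<bar>a j\<bar> powr p)"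
      using insert(1) by (simp only: lin avg_add avg_cmult bernoulli_avg_add bernoulli_avg_cmult)
        (simp add: avg_const bernoulli_avg_const)
    then show ?thesis by (simp add: c_def d_def algebra_simps)
  qed
  finally have "bernoulli_avg \<theta> (insert j I) (\<lambda>S. avg (signs (insert j I)) (\<lambda>\<epsilon>. \<bar>?s S \<epsilon>\<bar> powr p)) + B powr p
      \<le> (1 + c) * (?u + B powr p) + d" by (simp add: algebra_simps)
  also have "\<dots> \<le> (1 + c) * (?E * ?X) + d"
    using insert c by (intro add_right_mono mult_left_mono) auto
  \<comment> \<open>The bound 1 + c <= exp c lets the factors accumulate in the exponent; d may be
    multiplied by the exponentials because they are at least 1.\<close>
  also have "\<dots> \<le> exp c * (?E * ?X) + (exp c * ?E) * d"
  proof (intro add_mono mult_right_mono)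
    show "1 + c \<le> exp c" by (rule exp_ge_add_one_self)
    show "0 \<le> ?E * ?X" using K \<theta> by (intro mult_nonneg_nonneg add_nonneg_nonneg sum_nonneg) auto
    have "1 * 1 \<le> exp c * ?E" using c K \<theta> by (intro mult_mono) (auto simp: sum_nonneg)
    then show "d \<le> exp c * ?E * d" using mult_right_mono[OF _ d] by fastforce
  qed
  also have "\<dots> = exp (c + ?K * \<theta> * (\<Sum>i\<in>I. (a i)\<^sup>2) / B\<^sup>2) * (?X + d)"
    by (simp add: exp_add algebra_simps)
  also have "c + ?K * \<theta> * (\<Sum>i\<in>I. (a i)\<^sup>2) / B\<^sup>2 = ?K * \<theta> * (\<Sum>i\<in>insert j I. (a i)\<^sup>2) / B\<^sup>2"
    using insert by (simp add: c_def algebra_simps add_divide_distrib)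
  also have "?X + d = B powr p + ?K * \<theta> * (\<Sum>i\<in>insert j I. \<bar>a i\<bar> powr p)"
    using insert by (simp add: d_def algebra_simps)
  finally show ?case .
qed

text \<open>This is Rosenthal's inequality for independent symmetric variables that are a i or - a i
  if i is in S and 0 otherwise: their second and p-th moments are \<theta> (a i)^2 and \<theta> |a
  i|^p. The factor 3 bounds exp 1.\<close>

lemma rosenthal:
  fixes p \<theta> :: real and a :: "'i \<Rightarrow> real"
  assumes p: "p > 2" and \<theta>: "0 < \<theta>" "\<theta> \<le> 1" and I: "finite I"
  shows "bernoulli_avg \<theta> I (\<lambda>S. avg (signs I) (\<lambda>\<epsilon>. \<bar>\<Sum>i\<in>S. real_of_int (\<epsilon> i) * a i\<bar> powr p))
    \<le> 3 * (two_point_const p * \<theta> * (\<Sum>i\<in>I. \<bar>a i\<bar> powr p) + (two_point_const p * \<theta> * (\<Sum>i\<in>I. (a i)\<^sup>2)) powr (p / 2))"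
proof (cases "(\<Sum>i\<in>I. (a i)\<^sup>2) = 0")
  \<comment> \<open>B would be 0 here, and the auxiliary bound divides by it; but then every a i
    vanishes.\<close>
  case True
  then have z: "a i = 0" if "i \<in> I" for i using I that by (simp add: sum_nonneg_eq_0_iff)
  have "(\<Sum>i\<in>S. real_of_int (\<epsilon> i) * a i) = 0" if "S \<subseteq> I" for S and \<epsilon> :: "'i \<Rightarrow> int"
    using z that by (intro sum.neutral) auto
  then have "bernoulli_avg \<theta> I (\<lambda>S. avg (signs I) (\<lambda>\<epsilon>. \<bar>\<Sum>i\<in>S. real_of_int (\<epsilon> i) * a i\<bar> powr p)) = bernoulli_avg \<theta> I (\<lambda>S. avg (signs I) (\<lambda>\<epsilon>. 0))"
    using p by (intro bernoulli_avg_cong avg_cong) auto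
  then show ?thesis using \<theta> I by (simp add: avg_const bernoulli_avg_const two_point_const_def sum_nonneg)
next
  case False
  have K: "two_point_const p > 0" by (simp add: two_point_const_def add_pos_nonneg)
  define B where "B = sqrt (two_point_const p * \<theta> * (\<Sum>i\<in>I. (a i)\<^sup>2))"
  have pos: "two_point_const p * \<theta> * (\<Sum>i\<in>I. (a i)\<^sup>2) > 0"
    using False K \<theta> by (simp add: less_le sum_nonneg)
  then have B: "B > 0" "B\<^sup>2 = two_point_const p * \<theta> * (\<Sum>i\<in>I. (a i)\<^sup>2)"
    by (simp_all add: B_def less_imp_le)
  have Bp: "B powr p = (two_point_const p * \<theta> * (\<Sum>i\<in>I. (a i)\<^sup>2)) powr (p / 2)"
    using pos by (simp add: B_def powr_half_sqrt[symmetric] powr_powr)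
  have "bernoulli_avg \<theta> I (\<lambda>S. avg (signs I) (\<lambda>\<epsilon>. \<bar>\<Sum>i\<in>S. real_of_int (\<epsilon> i) * a i\<bar> powr p)) + B powr p
    \<le> exp 1 * (B powr p + two_point_const p * \<theta> * (\<Sum>i\<in>I. \<bar>a i\<bar> powr p))"
  proof -
    have "two_point_const p * \<theta> * (\<Sum>i\<in>I. (a i)\<^sup>2) / B\<^sup>2 = 1"
      unfolding B(2) using pos by (intro divide_self) auto
    then show ?thesis using rosenthal_aux[OF p _ \<theta>(2) B(1) I, of a] \<theta>(1) by (simp only: less_imp_le)
  qed
  also have "\<dots> \<le> 3 * (B powr p + two_point_const p * \<theta> * (\<Sum>i\<in>I. \<bar>a i\<bar> powr p))"
    using exp_le K \<theta> by (intro mult_right_mono add_nonneg_nonneg mult_nonneg_nonneg sum_nonneg) auto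
  finally have "bernoulli_avg \<theta> I (\<lambda>S. avg (signs I) (\<lambda>\<epsilon>. \<bar>\<Sum>i\<in>S. real_of_int (\<epsilon> i) * a i\<bar> powr p))
    \<le> 3 * (B powr p + two_point_const p * \<theta> * (\<Sum>i\<in>I. \<bar>a i\<bar> powr p))"
    by (smt (verit) powr_ge_zero)
  then show ?thesis unfolding Bp by (simp add: add.commute)
qed

section \<open>Smoothing on the torus\<close>

text \<open>The R + 1 possible values of a sum of R signs. Neighbours differ by 2, the distance
  between the two values of a sign, which makes sign increments telescope over it.\<close>

definition parity_interval :: "nat \<Rightarrow> int set" where
  "parity_interval R = (\<lambda>k. 2 * int k - int R) ` {..R}"

lemma parity_interval_alt: "parity_interval R = {z. \<bar>z\<bar> \<le> int R \<and> even (z + int R)}"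
proof (intro equalityI subsetI)
  fix z assume "z \<in> {z. \<bar>z\<bar> \<le> int R \<and> even (z + int R)}"
  then have z: "\<bar>z\<bar> \<le> int R" "even (z + int R)" by auto
  then obtain k where k: "z + int R = 2 * k" by (elim evenE)
  then show "z \<in> parity_interval R"
    unfolding parity_interval_def using z by (intro image_eqI[of _ _ "nat k"]) auto
qed (auto simp: parity_interval_def)

lemma finite_parity_interval [simp]: "finite (parity_interval R)" and parity_interval_nonempty [simp]: "parity_interval R \<noteq> {}"
  by (auto simp: parity_interval_def)

lemma inj_parity_interval: "inj_on (\<lambda>k. 2 * int k - int R) A"
  by (auto simp: inj_on_def)

lemma card_parity_interval: "card (parity_interval R) = Suc R"
  unfolding parity_interval_def by (simp add: card_image inj_parity_interval)

lemma avg_parity_interval_diff: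
  fixes \<phi> :: "int \<Rightarrow> real"
  shows "avg (parity_interval R) (\<lambda>v. \<phi> (v + 1) - \<phi> (v - 1)) = (\<phi> (int R + 1) - \<phi> (- int R - 1)) / real (Suc R)"
proof -
  have "(\<Sum>v\<in>parity_interval R. \<phi> (v + 1) - \<phi> (v - 1)) =
      (\<Sum>k<Suc R. \<phi> (2 * int (Suc k) - int R - 1) - \<phi> (2 * int k - int R - 1))"
    unfolding parity_interval_def by (subst sum.reindex[OF inj_parity_interval]) (simp add: lessThan_Suc_atMost algebra_simps)
  also have "\<dots> = \<phi> (int R + 1) - \<phi> (- int R - 1)"
    by (subst sum_lessThan_telescope[where f = "\<lambda>k. \<phi> (2 * int k - int R - 1)"]) (simp add: algebra_simps)
  finally show ?thesis by (simp add: avg_def card_parity_interval)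
qed

lemma parity_interval_path:
  assumes "z \<in> cube I (parity_interval R)"
  shows "\<exists>s. (\<forall>j<R. s j \<in> signs I) \<and> z = (\<Sum>j<R. s j)"
  using assms
proof (induction R arbitrary: z)
  case 0
  then have "z = 0" by (auto simp: cube_def parity_interval_def fun_eq_iff)
  then show ?case by auto
next
  case (Suc R)
  \<comment> \<open>One step towards 0 in every coordinate. Where z i = 0, parity makes R odd, so R
    >= 1 and the step - 1 stays in range.\<close>
  define t where "t = (\<lambda>i. if i \<in> I then if z i > 0 then 1 else - 1 else (0::int))"
  have t: "t \<in> signs I" by (simp add: t_def cube_def)
  have "z - t \<in> cube I (parity_interval R)"
    unfolding cube_def
  proof (intro CollectI conjI ballI allI impI)
    fix i assume i: "i \<in> I"
    then have "\<bar>z i\<bar> \<le> int R + 1" "even (z i + int R + 1)" using Suc.prems by (auto simp: cube_def parity_interval_alt)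
    then show "(z - t) i \<in> parity_interval R" using i unfolding parity_interval_alt t_def by (auto; presburger)
  qed (use Suc.prems in \<open>auto simp: cube_def t_def\<close>)
  from Suc.IH[OF this] obtain s where s: "\<forall>j<R. s j \<in> signs I" "z - t = (\<Sum>j<R. s j)" by blast
  have "z = (\<Sum>j<Suc R. (s(R := t)) j)" using s(2) by (simp add: algebra_simps)
  moreover have "\<forall>j<Suc R. (s(R := t)) j \<in> signs I" using s(1) t by (auto simp: less_Suc_eq)
  ultimately show ?case by blast
qed

text \<open>The summands come from the p-th moments of the mean increments, from their sum of
  squares, and from the dependence of the increments on the other signs. The outer 2^p separates the
  last from the first two.\<close>

definition Xp_const :: "real \<Rightarrow> real" where
  "Xp_const p = 2 powr p * (6 * 2 powr p * two_point_const p + 3 * two_point_const p powr (p / 2) * 2 powr p + 36 * p powr p * 4 powr p)"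

definition unit_vec :: "nat \<Rightarrow> nat \<Rightarrow> int" where
  "unit_vec i = (\<lambda>j. if j = i then 1 else 0)"

section \<open>Functions on the discrete torus and the moments of their displacements\<close>

locale torus =
  fixes n :: nat and N :: int and p :: real
  assumes N: "N > 0" and p: "p > 2"
begin

abbreviation I :: "nat set" where "I \<equiv> {..<n}"

definition red :: "(nat \<Rightarrow> int) \<Rightarrow> nat \<Rightarrow> int" where
  "red x = (\<lambda>i. if i \<in> I then x i mod N else 0)"

text \<open>A function on the torus is encoded as a function of all integer vectors that factors
  through \<open>red\<close>: it is N-periodic in the coordinates of I and ignores the others, so
  arguments can be shifted without reduction.\<close>

definition per :: "((nat \<Rightarrow> int) \<Rightarrow> real) \<Rightarrow> bool" where
  "per F \<longleftrightarrow> (\<forall>x. F (red x) = F x)"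

abbreviation T :: "(nat \<Rightarrow> int) set" where "T \<equiv> cube I {0..<N}"

lemma T_fin [simp]: "finite T" and T_ne [simp]: "T \<noteq> {}"
  using N by auto

lemma red_id: "x \<in> T \<Longrightarrow> red x = x"
  by (auto simp: red_def cube_def fun_eq_iff)

lemma red_mem: "red x \<in> T"
  using N by (auto simp: red_def cube_def)

lemma red_add: "red (red x + a) = red (x + a)"
  by (simp add: red_def fun_eq_iff mod_add_left_eq)

lemma per_shift: "per F \<Longrightarrow> F (red x + a) = F (x + a)"
  by (metis per_def red_add)

lemma bij_shift: "bij_betw (\<lambda>x. red (x + v)) T T"
proof (rule bij_betwI[where g = "\<lambda>x. red (x - v)"])
  show "red (red (x + v) - v) = x" if "x \<in> T" for x
    using red_add[of "x + v" "- v"] red_id[OF that] by simp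
  show "red (red (x - v) + v) = x" if "x \<in> T" for x
    using red_add[of "x - v" "v"] red_id[OF that] by simp
qed (auto simp: red_mem)

lemma avg_shift:
  assumes "per F"
  shows "avg T (\<lambda>x. F (x + v)) = avg T F"
  using avg_reindex[OF bij_shift, of F v] assms by (simp add: per_def)

text \<open>Its power 1 / p is the norm of f (. + v) - f in L_p of the torus; for periodic f it is
  symmetric and subadditive in v.\<close>

definition disp :: "((nat \<Rightarrow> int) \<Rightarrow> real) \<Rightarrow> (nat \<Rightarrow> int) \<Rightarrow> real" where
  "disp f v = avg T (\<lambda>x. \<bar>f (x + v) - f x\<bar> powr p)"

definition Delta :: "((nat \<Rightarrow> int) \<Rightarrow> real) \<Rightarrow> real" where
  "Delta f = avg (signs I) (disp f)"

lemma disp_nonneg: "0 \<le> disp f v"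
  unfolding disp_def by (intro avg_nonneg) auto

lemma Delta_nonneg: "0 \<le> Delta f"
  unfolding Delta_def by (intro avg_nonneg disp_nonneg)

text \<open>Invariance of the uniform measure on the torus under the shift by b.\<close>

lemma avg_diff_disp:
  assumes "per f"
  shows "avg T (\<lambda>x. \<bar>f (x + a) - f (x + b)\<bar> powr p) = disp f (a - b)"
proof -
  have "per (\<lambda>x. \<bar>f (x + (a - b)) - f x\<bar> powr p)"
    using per_shift[OF assms] assms by (simp add: per_def)
  from avg_shift[OF this, of b] show ?thesis
    unfolding disp_def by (simp add: add.assoc)
qed

lemma disp_minus: "per f \<Longrightarrow> disp f (- v) = disp f v"
  using avg_diff_disp[of f 0 v] unfolding disp_def by (simp add: abs_minus_commute)

lemma disp_add:
  assumes "per f"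
  shows "disp f (a + b) \<le> 2 powr p * (disp f a + disp f b)"
proof -
  have "disp f (a + b) \<le> avg T (\<lambda>x. 2 powr p * (\<bar>f (x + (a + b)) - f (x + a)\<bar> powr p + \<bar>f (x + a) - f x\<bar> powr p))"
    unfolding disp_def
  proof (rule avg_mono)
    fix x show "\<bar>f (x + (a + b)) - f x\<bar> powr p \<le> 2 powr p * (\<bar>f (x + (a + b)) - f (x + a)\<bar> powr p + \<bar>f (x + a) - f x\<bar> powr p)"
      using abs_add_powr_le[of p "f (x + (a + b)) - f (x + a)" "f (x + a) - f x"] p by simp
  qed
  also have "\<dots> = 2 powr p * (disp f b + disp f a)"
    by (simp add: avg_cmult avg_add avg_diff_disp[OF assms]) (simp add: disp_def)
  finally show ?thesis by (simp add: add.commute)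
qed

text \<open>The increment telescopes along the path with steps s j; by shift invariance it does not
  matter where on the path a step is made.\<close>

lemma disp_sum:
  assumes "per f"
  shows "disp f (\<Sum>j<R. s j) \<le> real R powr (p - 1) * (\<Sum>j<R. disp f (s j))"
proof -
  let ?d = "\<lambda>x j. f (x + (\<Sum>l<Suc j. s l)) - f (x + (\<Sum>l<j. s l))"
  have "disp f (\<Sum>j<R. s j) \<le> avg T (\<lambda>x. real R powr (p - 1) * (\<Sum>j<R. \<bar>?d x j\<bar> powr p))"
    unfolding disp_def
  proof (rule avg_mono)
    fix x
    have "f (x + (\<Sum>j<R. s j)) - f x = (\<Sum>j<R. ?d x j)"
      by (subst sum_lessThan_telescope[where f = "\<lambda>j. f (x + (\<Sum>l<j. s l))"]) simp
    then show "\<bar>f (x + (\<Sum>j<R. s j)) - f x\<bar> powr p \<le> real R powr (p - 1) * (\<Sum>j<R. \<bar>?d x j\<bar> powr p)"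
      using sum_abs_powr_le[of p "?d x" "{..<R}"] p by simp
  qed
  also have "\<dots> = real R powr (p - 1) * (\<Sum>j<R. disp f (s j))"
    by (simp only: avg_cmult avg_sum avg_diff_disp[OF assms]) simp
  finally show ?thesis .
qed

lemma disp_mult_nat:
  assumes "per f"
  shows "disp f (of_nat M * v) \<le> real M powr p * disp f v"
proof (cases "M = 0")
  case False
  have "(\<Sum>j<M. v) = of_nat M * v" by simp
  then have "disp f (of_nat M * v) \<le> real M powr (p - 1) * (real M * disp f v)"
    using disp_sum[OF assms, of "\<lambda>_. v" M] by simp
  also have "\<dots> = real M powr p * disp f v"
    using False by (simp add: powr_diff)
  finally show ?thesis .
qed (use p in \<open>simp add: disp_def avg_const\<close>)

section \<open>Averaging over a cube\<close>

definition smooth :: "nat \<Rightarrow> ((nat \<Rightarrow> int) \<Rightarrow> real) \<Rightarrow> (nat \<Rightarrow> int) \<Rightarrow> real" where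
  "smooth R f x = avg (cube I (parity_interval R)) (\<lambda>z. f (x + z))"

lemma per_smooth: "per f \<Longrightarrow> per (smooth R f)"
  unfolding smooth_def by (simp add: per_def per_shift)

text \<open>A path of sign vectors to a fixed \<open>z\<close> need not have uniformly distributed steps;
  multiplying by a random sign vector makes every step uniform.\<close>

lemma avg_disp_signs_mult:
  assumes "per f" "z \<in> cube I (parity_interval R)"
  shows "avg (signs I) (\<lambda>s. disp f (s * z)) \<le> real R powr p * Delta f"
proof -
  obtain s where s: "\<And>j. j < R \<Longrightarrow> s j \<in> signs I" and z: "z = (\<Sum>j<R. s j)"
    using parity_interval_path[OF assms(2)] by blast
  have "avg (signs I) (\<lambda>t. disp f (t * z)) \<le> avg (signs I) (\<lambda>t. real R powr (p - 1) * (\<Sum>j<R. disp f (s j * t)))"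
  proof (rule avg_mono)
    fix t :: "nat \<Rightarrow> int"
    have "t * z = (\<Sum>j<R. s j * t)" unfolding z by (subst mult.commute) (rule sum_distrib_right)
    then show "disp f (t * z) \<le> real R powr (p - 1) * (\<Sum>j<R. disp f (s j * t))"
      by (simp only: disp_sum[OF assms(1)])
  qed
  also have "\<dots> = real R powr (p - 1) * (\<Sum>j<R. Delta f)"
    unfolding avg_cmult avg_sum Delta_def using avg_signs_mult[OF s] by simp
  also have "\<dots> = real R powr p * Delta f"
    using p by (cases "R = 0") (simp_all add: powr_diff)
  finally show ?thesis .
qed

text \<open>The smoothing cube is invariant under changes of sign, so a random sign vector may be
  inserted before the path estimate is used.\<close>

lemma avg_disp_parity_interval:
  assumes "per f"
  shows "avg (cube I (parity_interval R)) (disp f) \<le> real R powr p * Delta f"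
proof -
  have "avg (cube I (parity_interval R)) (disp f) = avg (signs I) (\<lambda>s. avg (cube I (parity_interval R)) (disp f))"
    by (simp add: avg_const)
  also have "\<dots> = avg (signs I) (\<lambda>s. avg (cube I (parity_interval R)) (\<lambda>z. disp f (s * z)))"
  proof (rule avg_cong)
    fix s :: "nat \<Rightarrow> int" assume "s \<in> signs I"
    then have "bij_betw ((*) s) (cube I (parity_interval R)) (cube I (parity_interval R))"
      by (rule bij_cube_mult) (auto simp: parity_interval_alt)
    from avg_reindex[OF this]
    show "avg (cube I (parity_interval R)) (disp f) = avg (cube I (parity_interval R)) (\<lambda>z. disp f (s * z))" by simp
  qed
  also have "\<dots> = avg (cube I (parity_interval R)) (\<lambda>z. avg (signs I) (\<lambda>s. disp f (s * z)))"
    by (rule avg_swap)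
  also have "\<dots> \<le> avg (cube I (parity_interval R)) (\<lambda>z. real R powr p * Delta f)"
    by (intro avg_mono avg_disp_signs_mult assms)
  finally show ?thesis by (simp add: avg_const)
qed

text \<open>Every point of the smoothing cube is R sign steps away from its centre, which costs
  R^p.\<close>

lemma smooth_error:
  assumes "per f"
  shows "avg T (\<lambda>x. \<bar>smooth R f x - f x\<bar> powr p) \<le> real R powr p * Delta f"
proof -
  have "\<bar>smooth R f x - f x\<bar> powr p \<le> avg (cube I (parity_interval R)) (\<lambda>z. \<bar>f (x + z) - f x\<bar> powr p)" for x
  proof -
    have "smooth R f x - f x = avg (cube I (parity_interval R)) (\<lambda>z. f (x + z) - f x)"
      by (simp add: smooth_def avg_diff avg_const)
    then show ?thesis using p by (simp add: avg_abs_powr_le)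
  qed
  then have "avg T (\<lambda>x. \<bar>smooth R f x - f x\<bar> powr p)
      \<le> avg T (\<lambda>x. avg (cube I (parity_interval R)) (\<lambda>z. \<bar>f (x + z) - f x\<bar> powr p))"
    by (intro avg_mono)
  also have "\<dots> = avg (cube I (parity_interval R)) (disp f)"
    unfolding disp_def[abs_def] by (rule avg_swap)
  finally show ?thesis using avg_disp_parity_interval[OF assms, of R] by linarith
qed

text \<open>Smoothing is a mean of translations, hence a contraction in L_p.\<close>

lemma disp_smooth_le:
  assumes "per f"
  shows "disp (smooth R f) v \<le> disp f v"
proof -
  have "disp (smooth R f) v \<le> avg T (\<lambda>x. avg (cube I (parity_interval R)) (\<lambda>z. \<bar>f (x + (v + z)) - f (x + z)\<bar> powr p))"
    unfolding disp_def
  proof (rule avg_mono)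
    fix x
    have "smooth R f (x + v) - smooth R f x = avg (cube I (parity_interval R)) (\<lambda>z. f (x + (v + z)) - f (x + z))"
      by (simp add: smooth_def avg_diff add.assoc)
    then show "\<bar>smooth R f (x + v) - smooth R f x\<bar> powr p
        \<le> avg (cube I (parity_interval R)) (\<lambda>z. \<bar>f (x + (v + z)) - f (x + z)\<bar> powr p)"
      using p by (simp add: avg_abs_powr_le)
  qed
  also have "\<dots> = disp f v"
    by (subst avg_swap) (simp add: avg_diff_disp[OF assms] avg_const)
  finally show ?thesis .
qed

section \<open>Increments of the smoothed function in one coordinate\<close>

definition H :: "nat \<Rightarrow> ((nat \<Rightarrow> int) \<Rightarrow> real) \<Rightarrow> nat \<Rightarrow> (nat \<Rightarrow> int) \<Rightarrow> (nat \<Rightarrow> int) \<Rightarrow> real" where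
  "H R f i x d = smooth R f (x + d(i := 1)) - smooth R f (x + d(i := -1))"

lemma upd_add_upd:
  fixes d y :: "nat \<Rightarrow> int"
  shows "d(i := 1) + y(i := w) = d(i := 0) + y(i := w + 1)" "d(i := -1) + y(i := w) = d(i := 0) + y(i := w - 1)"
  by (simp_all add: fun_eq_iff)

text \<open>The smoothing in direction \<open>i\<close> telescopes, which is where the gain of \<open>1 / (R + 1)\<close> comes from.\<close>

lemma H_eq:
  assumes "i \<in> I"
  shows "H R f i x d = avg (cube I (parity_interval R)) (\<lambda>y.
     f (x + d(i := 0) + y(i := int R + 1)) - f (x + d(i := 0) + y(i := - int R - 1))) / real (Suc R)"
proof -
  have "H R f i x d = avg (cube I (parity_interval R)) (\<lambda>y. f (x + (d(i := 1) + y)) - f (x + (d(i := -1) + y)))"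
    unfolding H_def smooth_def by (simp add: avg_diff add.assoc)
  also have "\<dots> = avg (cube I (parity_interval R)) (\<lambda>y. avg (parity_interval R)
      (\<lambda>v. f (x + (d(i := 1) + y(i := v))) - f (x + (d(i := -1) + y(i := v)))))"
    using assms by (subst avg_cube_resample[symmetric, where i = i]) auto
  also have "\<dots> = avg (cube I (parity_interval R)) (\<lambda>y. avg (parity_interval R)
      (\<lambda>v. f (x + d(i := 0) + y(i := v + 1)) - f (x + d(i := 0) + y(i := v - 1))))"
    unfolding upd_add_upd by (simp add: add.assoc)
  also have "\<dots> = avg (cube I (parity_interval R)) (\<lambda>y. 1 / real (Suc R) * (
     f (x + d(i := 0) + y(i := int R + 1)) - f (x + d(i := 0) + y(i := - int R - 1))))"
    by (intro avg_cong)
      (subst avg_parity_interval_diff[where \<phi> = "\<lambda>v. f (x + _(i := 0) + _(i := v))"], simp)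
  finally show ?thesis unfolding avg_cmult by simp
qed

text \<open>After telescoping, both increments are differences between the same two faces, R + 1 to
  either side in coordinate i. Pairing the values on equal faces leaves the displacement z - d(i :=
  z i), whose i-th entry is 0.\<close>

lemma H_diff_le:
  assumes f: "per f" and i: "i \<in> I"
  shows "avg T (\<lambda>x. \<bar>H R f i x z - H R f i x d\<bar> powr p)
    \<le> 2 * 2 powr p / real (Suc R) powr p * disp f (z - d(i := z i))"
proof -
  let ?A = "\<lambda>w x y. f (x + (z(i := 0) + y(i := w))) - f (x + (d(i := 0) + y(i := w)))"
  let ?a = "int R + 1" and ?b = "- int R - 1"
  let ?Q = "cube I (parity_interval R)"
  let ?c = "2 powr p / real (Suc R) powr p"
  have pw: "\<bar>H R f i x z - H R f i x d\<bar> powr p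
      \<le> avg ?Q (\<lambda>y. ?c * (\<bar>?A ?a x y\<bar> powr p + \<bar>?A ?b x y\<bar> powr p))" for x
  proof -
    have "H R f i x z - H R f i x d = avg ?Q (\<lambda>y. (?A ?a x y - ?A ?b x y) / real (Suc R))"
      unfolding H_eq[OF i] by (simp add: avg_def sum_divide_distrib[symmetric] sum_subtractf diff_divide_distrib add.assoc mult.commute)
    then have "\<bar>H R f i x z - H R f i x d\<bar> powr p
        \<le> avg ?Q (\<lambda>y. \<bar>(?A ?a x y - ?A ?b x y) / real (Suc R)\<bar> powr p)"
      using p by (simp only: avg_abs_powr_le finite_cube finite_lessThan finite_parity_interval cube_nonempty parity_interval_nonempty not_False_eq_True)
    also have "\<dots> \<le> avg ?Q (\<lambda>y. ?c * (\<bar>?A ?a x y\<bar> powr p + \<bar>?A ?b x y\<bar> powr p))"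
    proof (rule avg_mono)
      fix y
      have "\<bar>?A ?a x y - ?A ?b x y\<bar> powr p \<le> 2 powr p * (\<bar>?A ?a x y\<bar> powr p + \<bar>?A ?b x y\<bar> powr p)"
        using p by (intro abs_diff_powr_le) simp
      then show "\<bar>(?A ?a x y - ?A ?b x y) / real (Suc R)\<bar> powr p \<le> ?c * (\<bar>?A ?a x y\<bar> powr p + \<bar>?A ?b x y\<bar> powr p)"
        by (simp only: abs_divide abs_of_nat powr_divide abs_ge_zero of_nat_0_le_iff abs_minus_cancel
            times_divide_eq_left divide_right_mono powr_ge_zero)
    qed
    finally show ?thesis .
  qed
  have d: "(z(i := 0) + y(i := w)) - (d(i := 0) + y(i := w)) = z - d(i := z i)" for y w
    by (simp add: fun_eq_iff)
  have "avg T (\<lambda>x. \<bar>H R f i x z - H R f i x d\<bar> powr p)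
      \<le> avg T (\<lambda>x. avg ?Q (\<lambda>y. ?c * (\<bar>?A ?a x y\<bar> powr p + \<bar>?A ?b x y\<bar> powr p)))"
    by (intro avg_mono pw)
  also have "\<dots> = avg ?Q (\<lambda>y. ?c * (disp f (z - d(i := z i)) + disp f (z - d(i := z i))))"
    by (subst avg_swap) (simp only: avg_cmult avg_add avg_diff_disp[OF f] d)
  also have "\<dots> = 2 * ?c * disp f (z - d(i := z i))"
    by (simp add: avg_const)
  finally show ?thesis by simp
qed

text \<open>The part of the increment that depends on no sign; it becomes the coefficient of
  \<epsilon> i in the Rademacher sum.\<close>

definition H_mean :: "nat \<Rightarrow> ((nat \<Rightarrow> int) \<Rightarrow> real) \<Rightarrow> nat \<Rightarrow> (nat \<Rightarrow> int) \<Rightarrow> real" where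
  "H_mean R f i x = avg (signs I) (H R f i x)"

text \<open>Jensen's inequality compares z with an independent copy d. Since H ignores the i-th
  entry of d, that entry may be taken from z; both z and the changed d are uniform sign vectors, so
  each contributes \<open>Delta f\<close>.\<close>

lemma H_error:
  assumes f: "per f" and i: "i \<in> I"
  shows "avg (signs I) (\<lambda>z. avg T (\<lambda>x. \<bar>H R f i x z - H_mean R f i x\<bar> powr p))
    \<le> 4 * 4 powr p / real (Suc R) powr p * Delta f"
proof -
  let ?c = "2 * 2 powr p / real (Suc R) powr p"
  have "avg (signs I) (\<lambda>z. avg T (\<lambda>x. \<bar>H R f i x z - H_mean R f i x\<bar> powr p))
      \<le> avg (signs I) (\<lambda>z. avg (signs I) (\<lambda>d. ?c * (2 powr p * (disp f z + disp f (d(i := z i))))))"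
  proof (rule avg_mono)
    fix z
    have "avg T (\<lambda>x. \<bar>H R f i x z - H_mean R f i x\<bar> powr p)
      \<le> avg T (\<lambda>x. avg (signs I) (\<lambda>d. \<bar>H R f i x z - H R f i x d\<bar> powr p))"
    proof (rule avg_mono)
      fix x
      have "H R f i x z - H_mean R f i x = avg (signs I) (\<lambda>d. H R f i x z - H R f i x d)"
        by (simp add: H_mean_def avg_diff avg_const)
      then show "\<bar>H R f i x z - H_mean R f i x\<bar> powr p \<le> avg (signs I) (\<lambda>d. \<bar>H R f i x z - H R f i x d\<bar> powr p)"
        using p by (simp add: avg_abs_powr_le)
    qed
    also have "\<dots> = avg (signs I) (\<lambda>d. avg T (\<lambda>x. \<bar>H R f i x z - H R f i x d\<bar> powr p))"
      by (rule avg_swap)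
    also have "\<dots> \<le> avg (signs I) (\<lambda>d. ?c * (2 powr p * (disp f z + disp f (d(i := z i)))))"
    proof (rule avg_mono)
      fix d
      have "disp f (z - d(i := z i)) \<le> 2 powr p * (disp f z + disp f (d(i := z i)))"
        using disp_add[OF f, of z "- d(i := z i)"] disp_minus[OF f] by simp
      then show "avg T (\<lambda>x. \<bar>H R f i x z - H R f i x d\<bar> powr p) \<le> ?c * (2 powr p * (disp f z + disp f (d(i := z i))))"
        using H_diff_le[OF f i, of R z d] by (smt (verit) mult_left_mono divide_nonneg_nonneg powr_ge_zero)
    qed
    finally show "avg T (\<lambda>x. \<bar>H R f i x z - H_mean R f i x\<bar> powr p) \<le> \<dots>" .
  qed
  also have "\<dots> = ?c * (2 powr p * (Delta f + avg (signs I) (\<lambda>z. avg (signs I) (\<lambda>d. disp f (d(i := z i))))))"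
    by (simp only: avg_cmult avg_add) (simp add: Delta_def avg_const)
  also have "avg (signs I) (\<lambda>z. avg (signs I) (\<lambda>d. disp f (d(i := z i))))
      = avg (signs I) (\<lambda>d. (disp f (d(i := 1)) + disp f (d(i := -1))) / 2)"
    by (subst avg_swap) (intro avg_cong avg_signs_coord i finite_lessThan)
  also have "\<dots> = Delta f" unfolding Delta_def by (rule avg_signs_resample[OF i])
  also have "?c * (2 powr p * (Delta f + Delta f)) = 4 * 4 powr p / real (Suc R) powr p * Delta f"
    using powr_mult[of 2 2 p] by simp
  finally show ?thesis .
qed

text \<open>The values 1 and -1 of coordinate i are two unit steps apart; smoothing and averaging
  over d do not increase p-th moments.\<close>

lemma H_mean_powr_le:
  assumes f: "per f" and i: "i \<in> I"
  shows "avg T (\<lambda>x. \<bar>H_mean R f i x\<bar> powr p) \<le> 2 * 2 powr p * disp f (unit_vec i)"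
proof -
  have "avg T (\<lambda>x. \<bar>H_mean R f i x\<bar> powr p) \<le> avg T (\<lambda>x. avg (signs I) (\<lambda>d. \<bar>H R f i x d\<bar> powr p))"
    unfolding H_mean_def using p by (intro avg_mono avg_abs_powr_le) auto
  also have "\<dots> = avg (signs I) (\<lambda>d. disp (smooth R f) (d(i := 1) - d(i := -1)))"
    unfolding H_def by (subst avg_swap) (simp only: avg_diff_disp[OF per_smooth[OF f]])
  also have "\<dots> \<le> avg (signs I) (\<lambda>d. 2 * 2 powr p * disp f (unit_vec i))"
  proof (rule avg_mono)
    fix d :: "nat \<Rightarrow> int"
    have "d(i := 1) - d(i := -1) = unit_vec i + unit_vec i" by (simp add: fun_eq_iff unit_vec_def)
    then show "disp (smooth R f) (d(i := 1) - d(i := -1)) \<le> 2 * 2 powr p * disp f (unit_vec i)"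
      using disp_smooth_le[OF f, of R "unit_vec i + unit_vec i"] disp_add[OF f, of "unit_vec i" "unit_vec i"] by simp
  qed
  finally show ?thesis by (simp add: avg_const)
qed

text \<open>Averaging over d i alone cancels \<open>smooth R f x\<close> and leaves half of H. So
  the mean increment is twice a first-order Fourier coefficient, and Bessel's inequality controls
  all i at once.\<close>

lemma H_mean_fourier:
  assumes i: "i \<in> I"
  shows "H_mean R f i x = 2 * avg (signs I) (\<lambda>d. real_of_int (d i) * (smooth R f (x + d) - smooth R f x))"
proof -
  have "avg (signs I) (\<lambda>d. real_of_int (d i) * (smooth R f (x + d) - smooth R f x))
      = avg (signs I) (\<lambda>d. 1 / 2 * H R f i x d)"
    by (subst avg_signs_resample[OF i, symmetric]) (simp add: H_def)
  then show ?thesis unfolding avg_cmult by (simp add: H_mean_def)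
qed

text \<open>Bessel's inequality at each x, Jensen's inequality with exponent p / 2 > 1, and
  contractivity of smoothing; the constant is 4^(p/2).\<close>

lemma H_mean_square_sum:
  assumes f: "per f"
  shows "avg T (\<lambda>x. (\<Sum>i\<in>I. (H_mean R f i x)\<^sup>2) powr (p / 2)) \<le> 2 powr p * Delta f"
proof -
  let ?g = "smooth R f"
  have "avg T (\<lambda>x. (\<Sum>i\<in>I. (H_mean R f i x)\<^sup>2) powr (p / 2))
      \<le> avg T (\<lambda>x. 2 powr p * avg (signs I) (\<lambda>d. \<bar>?g (x + d) - ?g x\<bar> powr p))"
  proof (rule avg_mono)
    fix x
    have "(\<Sum>i\<in>I. (H_mean R f i x)\<^sup>2) = 4 * (\<Sum>i\<in>I. (avg (signs I) (\<lambda>d. real_of_int (d i) * (?g (x + d) - ?g x)))\<^sup>2)"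
      unfolding sum_distrib_left by (intro sum.cong) (simp_all add: H_mean_fourier)
    also have "\<dots> \<le> 4 * avg (signs I) (\<lambda>d. (?g (x + d) - ?g x)\<^sup>2)"
      by (intro mult_left_mono signs_bessel) auto
    finally have "(\<Sum>i\<in>I. (H_mean R f i x)\<^sup>2) powr (p / 2) \<le> (4 * avg (signs I) (\<lambda>d. (?g (x + d) - ?g x)\<^sup>2)) powr (p / 2)"
      using p by (intro powr_mono2 sum_nonneg) auto
    also have "\<dots> = 4 powr (p / 2) * avg (signs I) (\<lambda>d. (?g (x + d) - ?g x)\<^sup>2) powr (p / 2)"
      by (rule powr_mult)
    also have "4 powr (p / 2) = (2 powr 2) powr (p / 2)" by simp
    also have "\<dots> = 2 powr p" by (subst powr_powr) simp
    also have "avg (signs I) (\<lambda>d. (?g (x + d) - ?g x)\<^sup>2) powr (p / 2)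
        \<le> avg (signs I) (\<lambda>d. ((?g (x + d) - ?g x)\<^sup>2) powr (p / 2))"
      using p by (intro avg_powr_le) auto
    also have "\<dots> = avg (signs I) (\<lambda>d. \<bar>?g (x + d) - ?g x\<bar> powr p)"
    proof (rule avg_cong)
      fix d
      have sq: "(?g (x + d) - ?g x)\<^sup>2 = \<bar>?g (x + d) - ?g x\<bar> powr 2"
        by simp
      show "((?g (x + d) - ?g x)\<^sup>2) powr (p / 2) = \<bar>?g (x + d) - ?g x\<bar> powr p"
        unfolding sq powr_powr by simp
    qed
    finally show "(\<Sum>i\<in>I. (H_mean R f i x)\<^sup>2) powr (p / 2) \<le> 2 powr p * avg (signs I) (\<lambda>d. \<bar>?g (x + d) - ?g x\<bar> powr p)"
      by simp
  qed
  also have "\<dots> = 2 powr p * avg (signs I) (disp ?g)"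
    unfolding avg_cmult disp_def[abs_def] by (subst avg_swap) simp
  also have "\<dots> \<le> 2 powr p * Delta f"
    unfolding Delta_def by (intro mult_left_mono avg_mono disp_smooth_le f) auto
  finally show ?thesis .
qed

text \<open>Multiplication by it flips the signs on S, so for S inside I the vector \<epsilon> -
  flipv S * \<epsilon> is 2 \<epsilon> on S and 0 elsewhere.\<close>

definition flipv :: "nat set \<Rightarrow> nat \<Rightarrow> int" where
  "flipv S = (\<lambda>i. if i \<in> I then if i \<in> S then -1 else 1 else 0)"

lemma flipv_signs: "flipv S \<in> signs I"
  by (auto simp: flipv_def cube_def)

text \<open>The coordinates of S are flipped in increasing order; when k is flipped, those of S
  below k already are, which explains the last argument of H.\<close>

lemma smooth_telescope:
  assumes \<epsilon>: "\<epsilon> \<in> signs I" and S: "S \<subseteq> I"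
  shows "smooth R f (x + \<epsilon>) - smooth R f (x + flipv S * \<epsilon>)
    = (\<Sum>k\<in>S. real_of_int (\<epsilon> k) * H R f k x (flipv (S \<inter> {..<k}) * \<epsilon>))"
proof -
  let ?z = "\<lambda>k. flipv (S \<inter> {..<k}) * \<epsilon>" and ?g = "smooth R f"
  have "?z 0 = \<epsilon>" "?z n = flipv S * \<epsilon>"
    using \<epsilon> S by (auto simp: flipv_def fun_eq_iff cube_def)
  then have "?g (x + \<epsilon>) - ?g (x + flipv S * \<epsilon>) = (\<Sum>k<n. ?g (x + ?z k) - ?g (x + ?z (Suc k)))"
    by (subst sum_lessThan_telescope') simp
  also have "\<dots> = (\<Sum>k<n. if k \<in> S then real_of_int (\<epsilon> k) * H R f k x (?z k) else 0)"
  proof (intro sum.cong refl)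
    fix k assume k: "k \<in> {..<n}"
    show "?g (x + ?z k) - ?g (x + ?z (Suc k)) = (if k \<in> S then real_of_int (\<epsilon> k) * H R f k x (?z k) else 0)"
    proof (cases "k \<in> S")
      case True
      have "?z k = (?z k)(k := \<epsilon> k)" "?z (Suc k) = (?z k)(k := - \<epsilon> k)"
        using True k by (auto simp: flipv_def fun_eq_iff)
      then have "?g (x + ?z k) - ?g (x + ?z (Suc k)) = ?g (x + (?z k)(k := \<epsilon> k)) - ?g (x + (?z k)(k := - \<epsilon> k))"
        by metis
      then show ?thesis using True signsD[OF \<epsilon> k] by (auto simp: H_def)
    next
      case False
      then have "S \<inter> {..<Suc k} = S \<inter> {..<k}" by (auto simp: less_Suc_eq)
      then show ?thesis using False by simp
    qed
  qed
  also have "\<dots> = (\<Sum>k\<in>S. real_of_int (\<epsilon> k) * H R f k x (?z k))"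
    using S by (simp add: sum.If_cases Int_absorb1)
  finally show ?thesis .
qed

section \<open>The metric \<open>X\<^sub>p\<close> inequality\<close>

text \<open>Each increment splits into its mean over the signs, which gives the Rademacher sum, and
  a deviation. The power mean inequality for the card S deviations produces card S ^ p.\<close>

lemma avg_disp_flip:
  assumes f: "per f" and S: "S \<subseteq> I"
  shows "avg (signs I) (\<lambda>\<epsilon>. disp (smooth R f) (\<epsilon> - flipv S * \<epsilon>))
    \<le> 2 powr p * (avg T (\<lambda>x. avg (signs I) (\<lambda>\<epsilon>. \<bar>\<Sum>k\<in>S. real_of_int (\<epsilon> k) * H_mean R f k x\<bar> powr p))
        + real (card S) powr p * (4 * 4 powr p / real (Suc R) powr p * Delta f))"
proof -
  let ?g = "smooth R f"
  let ?A = "\<lambda>\<epsilon> x. \<Sum>k\<in>S. real_of_int (\<epsilon> k) * H_mean R f k x"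
  let ?D = "\<lambda>\<epsilon> x k. H R f k x (flipv (S \<inter> {..<k}) * \<epsilon>) - H_mean R f k x"
  let ?s = "real (card S)"
  let ?E = "4 * 4 powr p / real (Suc R) powr p * Delta f"
  have pw: "\<bar>?g (x + \<epsilon>) - ?g (x + flipv S * \<epsilon>)\<bar> powr p
      \<le> 2 powr p * (\<bar>?A \<epsilon> x\<bar> powr p + ?s powr (p - 1) * (\<Sum>k\<in>S. \<bar>?D \<epsilon> x k\<bar> powr p))"
    if \<epsilon>: "\<epsilon> \<in> signs I" for \<epsilon> x
  proof -
    have "?g (x + \<epsilon>) - ?g (x + flipv S * \<epsilon>) = ?A \<epsilon> x + (\<Sum>k\<in>S. real_of_int (\<epsilon> k) * ?D \<epsilon> x k)"
      unfolding smooth_telescope[OF \<epsilon> S] by (simp add: algebra_simps sum_subtractf)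
    then have 1: "\<bar>?g (x + \<epsilon>) - ?g (x + flipv S * \<epsilon>)\<bar> powr p
        \<le> 2 powr p * (\<bar>?A \<epsilon> x\<bar> powr p + \<bar>\<Sum>k\<in>S. real_of_int (\<epsilon> k) * ?D \<epsilon> x k\<bar> powr p)"
      using p by (simp only: abs_add_powr_le)
    have "\<bar>\<Sum>k\<in>S. real_of_int (\<epsilon> k) * ?D \<epsilon> x k\<bar> powr p
        \<le> ?s powr (p - 1) * (\<Sum>k\<in>S. \<bar>real_of_int (\<epsilon> k) * ?D \<epsilon> x k\<bar> powr p)"
      using p by (intro sum_abs_powr_le) simp
    also have "(\<Sum>k\<in>S. \<bar>real_of_int (\<epsilon> k) * ?D \<epsilon> x k\<bar> powr p) = (\<Sum>k\<in>S. \<bar>?D \<epsilon> x k\<bar> powr p)"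
      using signsD[OF \<epsilon>] S by (intro sum.cong refl) (fastforce simp: abs_mult)
    finally show ?thesis
      by (intro order_trans[OF 1] mult_left_mono add_left_mono powr_ge_zero)
  qed
  have "avg (signs I) (\<lambda>\<epsilon>. disp ?g (\<epsilon> - flipv S * \<epsilon>))
      = avg (signs I) (\<lambda>\<epsilon>. avg T (\<lambda>x. \<bar>?g (x + \<epsilon>) - ?g (x + flipv S * \<epsilon>)\<bar> powr p))"
    by (simp only: avg_diff_disp[OF per_smooth[OF f]])
  also have "\<dots> \<le> avg (signs I) (\<lambda>\<epsilon>. avg T (\<lambda>x.
      2 powr p * (\<bar>?A \<epsilon> x\<bar> powr p + ?s powr (p - 1) * (\<Sum>k\<in>S. \<bar>?D \<epsilon> x k\<bar> powr p))))"
    by (intro avg_mono pw)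
  also have "\<dots> = 2 powr p * (avg (signs I) (\<lambda>\<epsilon>. avg T (\<lambda>x. \<bar>?A \<epsilon> x\<bar> powr p))
      + ?s powr (p - 1) * (\<Sum>k\<in>S. avg (signs I) (\<lambda>\<epsilon>. avg T (\<lambda>x. \<bar>?D \<epsilon> x k\<bar> powr p))))"
    by (simp only: avg_cmult avg_add avg_sum)
  also have "\<dots> \<le> 2 powr p * (avg T (\<lambda>x. avg (signs I) (\<lambda>\<epsilon>. \<bar>?A \<epsilon> x\<bar> powr p)) + ?s powr (p - 1) * (\<Sum>k\<in>S. ?E))"
  proof (intro mult_left_mono add_mono sum_mono)
    fix k assume "k \<in> S"
    then have k: "k \<in> I" using S by auto
    \<comment> \<open>The partially flipped \<epsilon> is again uniformly distributed, so the
      deviation estimate applies to it.\<close>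
    have "avg (signs I) (\<lambda>\<epsilon>. avg T (\<lambda>x. \<bar>?D \<epsilon> x k\<bar> powr p))
        = avg (signs I) (\<lambda>\<epsilon>. avg T (\<lambda>x. \<bar>H R f k x \<epsilon> - H_mean R f k x\<bar> powr p))"
      by (rule avg_signs_mult[OF flipv_signs, of "\<lambda>\<epsilon>. avg T (\<lambda>x. \<bar>H R f k x \<epsilon> - H_mean R f k x\<bar> powr p)"])
    then show "avg (signs I) (\<lambda>\<epsilon>. avg T (\<lambda>x. \<bar>?D \<epsilon> x k\<bar> powr p)) \<le> ?E"
      using H_error[OF f k, of R] by simp
  qed (simp_all add: avg_swap[of "signs I"])
  also have "?s powr (p - 1) * (\<Sum>k\<in>S. ?E) = (?s powr (p - 1) * ?s) * ?E" by simp
  also have "?s powr (p - 1) * ?s = ?s powr p"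
    using p by (cases "?s = 0") (simp_all add: powr_diff)
  finally show ?thesis .
qed

text \<open>For fixed x, Rosenthal's inequality is applied to the mean increments, jointly in S and
  \<epsilon>. The radius R = n makes the deviation term (card S / (n + 1))^p of order \<theta>^p on
  average.\<close>

lemma bernoulli_avg_disp_flip_smooth:
  assumes f: "per f" and \<theta>: "0 < \<theta>" "\<theta> \<le> 1" "\<theta> * real n \<ge> 1"
  shows "bernoulli_avg \<theta> I (\<lambda>S. avg (signs I) (\<lambda>\<epsilon>. disp (smooth n f) (\<epsilon> - flipv S * \<epsilon>)))
    \<le> Xp_const p * (\<theta> * (\<Sum>i\<in>I. disp f (unit_vec i)) + \<theta> powr (p / 2) * Delta f)"
proof -
  let ?A = "\<lambda>S \<epsilon> x. \<Sum>k\<in>S. real_of_int (\<epsilon> k) * H_mean n f k x"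
  let ?c = "4 * 4 powr p / real (Suc n) powr p * Delta f"
  let ?G = "\<Sum>i\<in>I. disp f (unit_vec i)"
  have K: "two_point_const p \<ge> 0" by (simp add: two_point_const_def)
  have c: "?c \<ge> 0" using Delta_nonneg by simp
  have G: "?G \<ge> 0" by (intro sum_nonneg disp_nonneg)
  have "bernoulli_avg \<theta> I (\<lambda>S. avg (signs I) (\<lambda>\<epsilon>. disp (smooth n f) (\<epsilon> - flipv S * \<epsilon>)))
      \<le> bernoulli_avg \<theta> I (\<lambda>S. 2 powr p * (avg T (\<lambda>x. avg (signs I) (\<lambda>\<epsilon>. \<bar>?A S \<epsilon> x\<bar> powr p)) + ?c * real (card S) powr p))"
    using \<theta> by (intro bernoulli_avg_mono order_trans[OF avg_disp_flip[OF f]]) (auto simp: mult.commute)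
  also have "\<dots> = 2 powr p * (avg T (\<lambda>x. bernoulli_avg \<theta> I (\<lambda>S. avg (signs I) (\<lambda>\<epsilon>. \<bar>?A S \<epsilon> x\<bar> powr p)))
      + ?c * bernoulli_avg \<theta> I (\<lambda>S. real (card S) powr p))"
    by (simp only: bernoulli_avg_cmult bernoulli_avg_add bernoulli_avg_avg)
  also have "\<dots> \<le> 2 powr p * ((6 * 2 powr p * two_point_const p * \<theta> * ?G + 3 * two_point_const p powr (p / 2) * \<theta> powr (p / 2) * (2 powr p * Delta f))
      + 36 * p powr p * 4 powr p * \<theta> powr (p / 2) * Delta f)"
  proof (intro mult_left_mono add_mono)
    have "avg T (\<lambda>x. bernoulli_avg \<theta> I (\<lambda>S. avg (signs I) (\<lambda>\<epsilon>. \<bar>?A S \<epsilon> x\<bar> powr p)))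
        \<le> avg T (\<lambda>x. 3 * (two_point_const p * \<theta> * (\<Sum>i\<in>I. \<bar>H_mean n f i x\<bar> powr p)
             + (two_point_const p * \<theta>) powr (p / 2) * (\<Sum>i\<in>I. (H_mean n f i x)\<^sup>2) powr (p / 2)))"
      using rosenthal[OF p \<theta>(1,2), of I] by (intro avg_mono) (simp add: powr_mult)
    also have "\<dots> = 3 * (two_point_const p * \<theta> * (\<Sum>i\<in>I. avg T (\<lambda>x. \<bar>H_mean n f i x\<bar> powr p))
             + (two_point_const p * \<theta>) powr (p / 2) * avg T (\<lambda>x. (\<Sum>i\<in>I. (H_mean n f i x)\<^sup>2) powr (p / 2)))"
      by (simp only: avg_cmult avg_add avg_sum)
    also have "\<dots> \<le> 3 * (two_point_const p * \<theta> * (\<Sum>i\<in>I. 2 * 2 powr p * disp f (unit_vec i))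
             + (two_point_const p * \<theta>) powr (p / 2) * (2 powr p * Delta f))"
      using K \<theta> by (intro mult_left_mono add_mono sum_mono H_mean_powr_le H_mean_square_sum f) auto
    also have "\<dots> = 6 * 2 powr p * two_point_const p * \<theta> * ?G + 3 * two_point_const p powr (p / 2) * \<theta> powr (p / 2) * (2 powr p * Delta f)"
      by (simp add: powr_mult sum_distrib_left[symmetric] algebra_simps)
    finally show "avg T (\<lambda>x. bernoulli_avg \<theta> I (\<lambda>S. avg (signs I) (\<lambda>\<epsilon>. \<bar>?A S \<epsilon> x\<bar> powr p))) \<le> \<dots>" .
  next
    have n: "real n / real (Suc n) \<le> 1" by simp
    have "?c * bernoulli_avg \<theta> I (\<lambda>S. real (card S) powr p) \<le> ?c * (9 * p powr p * (\<theta> * real n) powr p)"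
      using bernoulli_avg_card_powr_le[of I \<theta> p] \<theta> p c by (intro mult_left_mono) auto
    also have "\<dots> = 36 * p powr p * 4 powr p * Delta f * (\<theta> powr p * (real n / real (Suc n)) powr p)"
      by (simp add: powr_mult powr_divide)
    also have "\<dots> \<le> 36 * p powr p * 4 powr p * Delta f * (\<theta> powr (p / 2) * 1)"
    proof (intro mult_left_mono mult_mono)
      show "\<theta> powr p \<le> \<theta> powr (p / 2)" using \<theta> p by (intro powr_mono') auto
      show "(real n / real (Suc n)) powr p \<le> 1"
        using powr_mono2[OF _ _ n, of p] p by simp
    qed (use Delta_nonneg in auto)
    finally show "?c * bernoulli_avg \<theta> I (\<lambda>S. real (card S) powr p) \<le> 36 * p powr p * 4 powr p * \<theta> powr (p / 2) * Delta f"
      by (simp add: mult_ac)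
  qed auto
  also have "\<dots> \<le> Xp_const p * (\<theta> * ?G + \<theta> powr (p / 2) * Delta f)"
  proof -
    have "a * g + b * d + e * d \<le> (a + b + e) * (g + d)" if "a \<ge> 0" "b \<ge> 0" "e \<ge> 0" "g \<ge> 0" "d \<ge> 0" for a b e g d :: real
      using that by (simp add: algebra_simps add_nonneg_nonneg)
    from this[of "6 * 2 powr p * two_point_const p" "3 * two_point_const p powr (p / 2) * 2 powr p" "36 * p powr p * 4 powr p" "\<theta> * ?G" "\<theta> powr (p / 2) * Delta f"]
    have "6 * 2 powr p * two_point_const p * (\<theta> * ?G) + 3 * two_point_const p powr (p / 2) * 2 powr p * (\<theta> powr (p / 2) * Delta f)
      + 36 * p powr p * 4 powr p * (\<theta> powr (p / 2) * Delta f) \<le>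
      (6 * 2 powr p * two_point_const p + 3 * two_point_const p powr (p / 2) * 2 powr p + 36 * p powr p * 4 powr p) * (\<theta> * ?G + \<theta> powr (p / 2) * Delta f)"
      using K \<theta> G Delta_nonneg[of f] by simp
    from mult_left_mono[OF this, of "2 powr p"] show ?thesis
      unfolding Xp_const_def by (simp add: mult_ac)
  qed
  finally show ?thesis .
qed

text \<open>The smoothed function replaces f at both ends, which costs R^p twice but without the
  factor M^p; only the smoothed increment is walked M times.\<close>

lemma disp_scale_le:
  assumes f: "per f"
  shows "disp f (of_nat M * v) \<le> 4 powr p * (2 * (real R powr p * Delta f) + real M powr p * disp (smooth R f) v)"
proof -
  let ?g = "smooth R f" and ?v = "of_nat M * v"
  have "disp f ?v \<le> avg T (\<lambda>x. 4 powr p * (\<bar>?g (x + ?v) - f (x + ?v)\<bar> powr p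
      + \<bar>?g (x + ?v) - ?g x\<bar> powr p + \<bar>?g x - f x\<bar> powr p))"
    unfolding disp_def
  proof (rule avg_mono)
    fix x
    show "\<bar>f (x + ?v) - f x\<bar> powr p \<le> 4 powr p * (\<bar>?g (x + ?v) - f (x + ?v)\<bar> powr p
      + \<bar>?g (x + ?v) - ?g x\<bar> powr p + \<bar>?g x - f x\<bar> powr p)"
      using abs_add3_powr_le[of p "f (x + ?v) - ?g (x + ?v)" "?g (x + ?v) - ?g x" "?g x - f x"] p
      by (simp add: abs_minus_commute)
  qed
  also have "\<dots> = 4 powr p * (avg T (\<lambda>x. \<bar>?g (x + ?v) - f (x + ?v)\<bar> powr p)
      + disp ?g ?v + avg T (\<lambda>x. \<bar>?g x - f x\<bar> powr p))"
    by (simp only: avg_cmult avg_add disp_def)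
  also have "avg T (\<lambda>x. \<bar>?g (x + ?v) - f (x + ?v)\<bar> powr p) = avg T (\<lambda>x. \<bar>?g x - f x\<bar> powr p)"
  proof -
    have "per (\<lambda>x. \<bar>?g x - f x\<bar> powr p)"
      using f per_smooth[OF f, of R] by (simp add: per_def)
    then show ?thesis by (rule avg_shift)
  qed
  also have "4 powr p * (avg T (\<lambda>x. \<bar>?g x - f x\<bar> powr p) + disp ?g ?v + avg T (\<lambda>x. \<bar>?g x - f x\<bar> powr p))
     \<le> 4 powr p * (real R powr p * Delta f + real M powr p * disp ?g v + real R powr p * Delta f)"
    by (intro mult_left_mono add_mono smooth_error f disp_mult_nat per_smooth) auto
  also have "\<dots> = 4 powr p * (2 * (real R powr p * Delta f) + real M powr p * disp ?g v)"
    by (rule arg_cong[where f = "\<lambda>t. _ * t"]) linarith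
  finally show ?thesis .
qed

theorem metric_Xp_inequality:
  assumes f: "per f" and \<theta>: "0 < \<theta>" "\<theta> \<le> 1" "\<theta> * real n \<ge> 1"
    and M: "real n \<le> real M * \<theta> powr (1 / 2)"
  shows "bernoulli_avg \<theta> I (\<lambda>S. avg (signs I) (\<lambda>\<epsilon>. disp f (of_nat M * (\<epsilon> - flipv S * \<epsilon>))))
    \<le> 4 powr p * (Xp_const p + 2) * real M powr p * (\<theta> * (\<Sum>i\<in>I. disp f (unit_vec i)) + \<theta> powr (p / 2) * Delta f)"
proof -
  let ?g = "smooth n f"
  let ?G = "\<Sum>i\<in>I. disp f (unit_vec i)"
  have G: "?G \<ge> 0" by (intro sum_nonneg disp_nonneg)
  have "bernoulli_avg \<theta> I (\<lambda>S. avg (signs I) (\<lambda>\<epsilon>. disp f (of_nat M * (\<epsilon> - flipv S * \<epsilon>))))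
     \<le> bernoulli_avg \<theta> I (\<lambda>S. avg (signs I) (\<lambda>\<epsilon>. 4 powr p * (2 * (real n powr p * Delta f) + real M powr p * disp ?g (\<epsilon> - flipv S * \<epsilon>))))"
    using \<theta> by (intro bernoulli_avg_mono avg_mono disp_scale_le f) auto
  also have "\<dots> = 4 powr p * (2 * (real n powr p * Delta f)
      + real M powr p * bernoulli_avg \<theta> I (\<lambda>S. avg (signs I) (\<lambda>\<epsilon>. disp ?g (\<epsilon> - flipv S * \<epsilon>))))"
    by (simp only: avg_cmult avg_add bernoulli_avg_cmult bernoulli_avg_add) (simp add: avg_const bernoulli_avg_const)
  also have "\<dots> \<le> 4 powr p * (2 * (real M powr p * (\<theta> * ?G + \<theta> powr (p / 2) * Delta f))
      + real M powr p * (Xp_const p * (\<theta> * ?G + \<theta> powr (p / 2) * Delta f)))"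
  proof (intro mult_left_mono add_mono bernoulli_avg_disp_flip_smooth f \<theta>)
    \<comment> \<open>Here the condition on M absorbs the smoothing error into the diagonal
      term.\<close>
    have "real n powr p \<le> (real M * \<theta> powr (1 / 2)) powr p"
      using M p by (intro powr_mono2) auto
    also have "\<dots> = real M powr p * \<theta> powr (p / 2)" by (simp add: powr_mult powr_powr)
    finally have "real n powr p * Delta f \<le> real M powr p * \<theta> powr (p / 2) * Delta f"
      by (intro mult_right_mono Delta_nonneg)
    also have "\<dots> \<le> real M powr p * (\<theta> * ?G + \<theta> powr (p / 2) * Delta f)"
      using \<theta> G by (simp add: algebra_simps)
    finally show "real n powr p * Delta f \<le> real M powr p * (\<theta> * ?G + \<theta> powr (p / 2) * Delta f)" .
  qed auto
  finally show ?thesis by (simp add: algebra_simps)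
qed

end

section \<open>Folding the torus onto the grid\<close>

text \<open>For M > 0, the distance from y to the nearest multiple of 8 M: a triangle wave that
  folds the cyclic group of order 8 M onto the path 0, ..., 4 M.\<close>

definition fold_int :: "nat \<Rightarrow> int \<Rightarrow> int" where
  "fold_int M y = min (y mod (8 * int M)) (8 * int M - y mod (8 * int M))"

lemma fold_int_mod: "fold_int M (y mod (8 * int M)) = fold_int M y"
  by (simp add: fold_int_def)

lemma fold_int_range:
  assumes "M > 0" shows "0 \<le> fold_int M y" "fold_int M y \<le> 4 * int M"
proof -
  have "0 \<le> y mod (8 * int M)" "y mod (8 * int M) < 8 * int M" using assms by auto
  then show "0 \<le> fold_int M y" "fold_int M y \<le> 4 * int M" by (auto simp: fold_int_def)
qed

lemma fold_int_Suc:
  assumes "M > 0" shows "\<bar>fold_int M (y + 1) - fold_int M y\<bar> \<le> 1"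
proof -
  have r: "0 \<le> y mod (8 * int M)" "y mod (8 * int M) < 8 * int M" using assms by auto
  have "(y + 1) mod (8 * int M) = (if y mod (8 * int M) + 1 = 8 * int M then 0 else y mod (8 * int M) + 1)"
    using r by (auto simp: mod_add_left_eq[symmetric, of y] simp del: mod_add_left_eq intro!: mod_pos_pos_trivial)
  then show ?thesis using r by (auto simp: fold_int_def)
qed

lemma fold_int_lipschitz:
  assumes "M > 0" "\<bar>e\<bar> \<le> 1" shows "\<bar>fold_int M (y + e) - fold_int M y\<bar> \<le> 1"
proof -
  consider "e = 0" | "e = 1" | "e = -1" using assms(2) by linarith
  then show ?thesis
    using fold_int_Suc[OF assms(1), of y] fold_int_Suc[OF assms(1), of "y - 1"]
    by cases (auto simp: abs_minus_commute)
qed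

lemma fold_int_half: 
  assumes "0 \<le> y" "y \<le> 4 * int M" shows "fold_int M y = y"
  using assms by (cases "M = 0") (auto simp: fold_int_def mod_pos_pos_trivial)

text \<open>On a quarter of the period the fold is an isometry along the whole shift by \<open>2 M\<close>.\<close>

lemma avg_fold_int_ge:
  assumes M: "M > 0" and e: "e = 1 \<or> e = -1" and q: "q > 0"
  shows "(2 * real M) powr q / 4 \<le>
    avg {0..<8 * int M} (\<lambda>y. \<bar>real_of_int (fold_int M (y + 2 * int M * e) - fold_int M y)\<bar> powr q)"
proof -
  \<comment> \<open>Starting points for which y and y + 2 M e both lie between 0 and 4 M, where the
    fold is the identity: 2 M of the 8 M residues.\<close>
  define A where "A = (if e = 1 then {0..<2 * int M} else {2 * int M..<4 * int M})"
  have A: "A \<subseteq> {0..<8 * int M}" "card A = 2 * M" by (auto simp: A_def)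
  have "\<bar>fold_int M (y + 2 * int M * e) - fold_int M y\<bar> = 2 * int M" if "y \<in> A" for y
    using that e by (auto simp: A_def fold_int_half)
  then have "(\<Sum>y\<in>A. \<bar>real_of_int (fold_int M (y + 2 * int M * e) - fold_int M y)\<bar> powr q) = (\<Sum>y\<in>A. (2 * real M) powr q)"
    by (intro sum.cong refl) (metis of_int_abs of_int_mult of_int_numeral of_int_of_nat_eq)
  also have "\<dots> = 2 * real M * (2 * real M) powr q" by (simp add: A(2))
  finally have "2 * real M * (2 * real M) powr q \<le>
      (\<Sum>y\<in>{0..<8 * int M}. \<bar>real_of_int (fold_int M (y + 2 * int M * e) - fold_int M y)\<bar> powr q)"
    using sum_mono2[OF _ A(1), of "\<lambda>y. \<bar>real_of_int (fold_int M (y + 2 * int M * e) - fold_int M y)\<bar> powr q"] by simp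
  then show ?thesis using M by (simp add: avg_def field_simps)
qed

section \<open>From real-valued functions to L_p by integration\<close>

abbreviation unit_interval :: "real measure" where
  "unit_interval \<equiv> restrict_space lborel {0..1}"

text \<open>Moments can be summed and compared under the integral only once they are known to be
  integrable, since a non-integrable function has Bochner integral 0.\<close>

lemma Lp01_integrable:
  assumes "Lp01_mem p g" "Lp01_mem p h" "p > 1"
  shows "integrable unit_interval (\<lambda>t. \<bar>g t - h t\<bar> powr p)"
proof -
  have gh: "integrable unit_interval (\<lambda>t. \<bar>g t\<bar> powr p)" "integrable unit_interval (\<lambda>t. \<bar>h t\<bar> powr p)"
    using assms by (auto simp: Lp01_mem_def integrable_restrict_space set_integrable_def)
  have [measurable]: "g \<in> borel_measurable unit_interval" "h \<in> borel_measurable unit_interval"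
    using assms by (auto simp: Lp01_mem_def intro: measurable_restrict_space1)
  show ?thesis
  proof (rule Bochner_Integration.integrable_bound)
    show "integrable unit_interval (\<lambda>t. 2 powr p * (\<bar>g t\<bar> powr p + \<bar>h t\<bar> powr p))"
      using gh by simp
    show "AE t in unit_interval. norm (\<bar>g t - h t\<bar> powr p) \<le> norm (2 powr p * (\<bar>g t\<bar> powr p + \<bar>h t\<bar> powr p))"
      using abs_diff_powr_le[OF assms(3)] by (intro always_eventually allI) simp
  qed simp
qed

lemma Lp01_dist_powr:
  assumes "p > 1"
  shows "Lp01_dist p g h powr p = (LINT t|unit_interval. \<bar>g t - h t\<bar> powr p)"
proof -
  have "(LINT t|unit_interval. \<bar>g t - h t\<bar> powr p) = (LINT t:{0..1}|lborel. \<bar>g t - h t\<bar> powr p)"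
    unfolding set_lebesgue_integral_def by (rule integral_restrict_space) simp
  moreover have "0 \<le> (LINT t|unit_interval. \<bar>g t - h t\<bar> powr p)"
    by (intro integral_nonneg_AE) auto
  ultimately show ?thesis
    using assms by (simp add: Lp01_dist_def powr_powr)
qed

lemma integrable_avg:
  assumes "\<And>x. x \<in> A \<Longrightarrow> integrable L (F x)"
  shows "integrable L (\<lambda>t. avg A (\<lambda>x. F x t))"
  unfolding avg_def using assms by (intro integrable_divide Bochner_Integration.integrable_sum)

lemma integral_avg:
  assumes "\<And>x. x \<in> A \<Longrightarrow> integrable L (F x)"
  shows "(LINT t|L. avg A (\<lambda>x. F x t)) = avg A (\<lambda>x. LINT t|L. F x t)"
  unfolding avg_def using assms by (simp add: Bochner_Integration.integral_sum)

lemma integrable_bernoulli_avg: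
  assumes "\<And>S. S \<subseteq> I \<Longrightarrow> integrable L (F S)"
  shows "integrable L (\<lambda>t. bernoulli_avg \<theta> I (\<lambda>S. F S t))"
  unfolding bernoulli_avg_def using assms by (intro Bochner_Integration.integrable_sum integrable_mult_right) auto

lemma integral_bernoulli_avg:
  assumes "\<And>S. S \<subseteq> I \<Longrightarrow> integrable L (F S)"
  shows "(LINT t|L. bernoulli_avg \<theta> I (\<lambda>S. F S t)) = bernoulli_avg \<theta> I (\<lambda>S. LINT t|L. F S t)"
  unfolding bernoulli_avg_def using assms by (subst Bochner_Integration.integral_sum) auto

section \<open>The folded grid and its distances\<close>

definition fold_grid :: "nat \<Rightarrow> nat \<Rightarrow> (nat \<Rightarrow> int) \<Rightarrow> nat \<Rightarrow> nat" where
  "fold_grid M n x = (\<lambda>i. if i < n then nat (fold_int M (x i)) else 0)"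

lemma fold_grid_grid: "M > 0 \<Longrightarrow> 4 * M \<le> m \<Longrightarrow> fold_grid M n x \<in> grid m n"
  using fold_int_range(2)[of M] by (fastforce simp: grid_def fold_grid_def nat_le_iff intro: order_trans)

lemma fold_grid_diff:
  assumes "M > 0" "i < n"
  shows "real (fold_grid M n x i) - real (fold_grid M n y i) = real_of_int (fold_int M (x i) - fold_int M (y i))"
  using fold_int_range(1)[OF assms(1)] assms(2) by (simp add: fold_grid_def)

lemma lq_dist_fold_grid:
  assumes "M > 0"
  shows "lq_dist q n (fold_grid M n x) (fold_grid M n y) = (\<Sum>i<n. \<bar>real_of_int (fold_int M (x i) - fold_int M (y i))\<bar> powr q) powr (1 / q)"
  unfolding lq_dist_def using fold_grid_diff[OF assms] by simp

lemma lq_dist_fold_grid_unit: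
  assumes "M > 0" "q > 0" "i < n"
  shows "lq_dist q n (fold_grid M n (x + unit_vec i)) (fold_grid M n x) \<le> 1"
proof -
  have "(\<Sum>j<n. \<bar>real_of_int (fold_int M ((x + unit_vec i) j) - fold_int M (x j))\<bar> powr q) \<le> (\<Sum>j<n. if j = i then 1 else 0)"
  proof (rule sum_mono)
    fix j
    have "\<bar>real_of_int (fold_int M (x j + 1) - fold_int M (x j))\<bar> \<le> 1"
      using fold_int_Suc[OF assms(1), of "x j"] by linarith
    then show "\<bar>real_of_int (fold_int M ((x + unit_vec i) j) - fold_int M (x j))\<bar> powr q \<le> (if j = i then 1 else 0)"
      using assms powr_mono2[of q _ 1] by (auto simp: unit_vec_def)
  qed
  also have "\<dots> = 1" using assms by simp
  finally show ?thesis
    unfolding lq_dist_fold_grid[OF assms(1)] using assms powr_mono2[of "1 / q" _ 1] by (simp add: sum_nonneg)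
qed

lemma lq_dist_fold_grid_sign:
  assumes "M > 0" "q > 0" "\<epsilon> \<in> signs {..<n}"
  shows "lq_dist q n (fold_grid M n (x + \<epsilon>)) (fold_grid M n x) \<le> real n powr (1 / q)"
proof -
  have "(\<Sum>j<n. \<bar>real_of_int (fold_int M ((x + \<epsilon>) j) - fold_int M (x j))\<bar> powr q) \<le> (\<Sum>j<n. 1)"
  proof (rule sum_mono)
    fix j assume "j \<in> {..<n}"
    then have "\<bar>\<epsilon> j\<bar> \<le> 1" using signsD[OF assms(3)] by force
    from fold_int_lipschitz[OF assms(1) this, of "x j"]
    have "\<bar>real_of_int (fold_int M (x j + \<epsilon> j) - fold_int M (x j))\<bar> \<le> 1" by linarith
    then show "\<bar>real_of_int (fold_int M ((x + \<epsilon>) j) - fold_int M (x j))\<bar> powr q \<le> 1"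
      using assms powr_mono2[of q _ 1] by auto
  qed
  then show ?thesis
    unfolding lq_dist_fold_grid[OF assms(1)] using assms by (intro powr_mono2) (auto simp: sum_nonneg)
qed

text \<open>For each t the inequality on the torus of side 8 M is applied to the t-th value of f
  after folding, and integrated over t. The upper bound on f enters on the right through edges and
  diagonals. The lower bound enters on the left through the q-th power of the distance, whose mean
  is at least a multiple of card S. Finally s^p M^p cancels.\<close>

lemma Xp_grid:
  fixes p q s D \<theta> :: real and f :: "(nat \<Rightarrow> nat) \<Rightarrow> real \<Rightarrow> real"
  assumes q: "2 < q" "q < p" and \<theta>: "0 < \<theta>" "\<theta> \<le> 1" "\<theta> * real n \<ge> 1"
    and M: "M > 0" "4 * M \<le> m" "real n \<le> real M * \<theta> powr (1 / 2)" and s: "s > 0" and D: "D \<ge> 1"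
    and mem: "\<And>x. x \<in> grid m n \<Longrightarrow> Lp01_mem p (f x)"
    and lower: "\<And>x y. x \<in> grid m n \<Longrightarrow> y \<in> grid m n \<Longrightarrow> s * lq_dist q n x y \<le> Lp01_dist p (f x) (f y)"
    and upper: "\<And>x y. x \<in> grid m n \<Longrightarrow> y \<in> grid m n \<Longrightarrow> Lp01_dist p (f x) (f y) \<le> D * s * lq_dist q n x y"
  shows "(\<theta> * real n) powr (p / q) \<le>
    4 powr p * (Xp_const p + 2) * D powr p * (\<theta> * real n + \<theta> powr (p / 2) * real n powr (p / q))"
proof -
  interpret torus n "8 * int M" p using M q by unfold_locales auto
  let ?L = "unit_interval"
  define F where "F t x = f (fold_grid M n x) t" for t x
  define P where "P v = avg T (\<lambda>x. LINT t|?L. \<bar>F t (x + v) - F t x\<bar> powr p)" for v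
  define C where "C = 4 powr p * (Xp_const p + 2)"
  let ?v = "\<lambda>S \<epsilon>. of_nat M * (\<epsilon> - flipv S * \<epsilon>)"
  have C: "C \<ge> 0" by (simp add: C_def Xp_const_def two_point_const_def)
  have g: "fold_grid M n x \<in> grid m n" for x using M by (intro fold_grid_grid)
  have per: "per (F t)" for t
  proof -
    have "fold_grid M n (red x) = fold_grid M n x" for x
      by (auto simp: fold_grid_def red_def fold_int_mod fun_eq_iff)
    then show ?thesis by (simp add: per_def F_def)
  qed
  have int: "integrable ?L (\<lambda>t. \<bar>F t (x + v) - F t x\<bar> powr p)" for x v
    unfolding F_def using p by (intro Lp01_integrable mem g) auto
  have LINT: "(LINT t|?L. \<bar>F t (x + v) - F t x\<bar> powr p) = Lp01_dist p (f (fold_grid M n (x + v))) (f (fold_grid M n x)) powr p" for x v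
    unfolding F_def using p by (intro Lp01_dist_powr[symmetric]) auto
  have intd: "integrable ?L (\<lambda>t. disp (F t) v)" for v
    unfolding disp_def by (intro integrable_avg int)
  have P: "(LINT t|?L. disp (F t) v) = P v" for v
    unfolding disp_def P_def by (intro integral_avg int)
  have main: "bernoulli_avg \<theta> I (\<lambda>S. avg (signs I) (\<lambda>\<epsilon>. P (?v S \<epsilon>)))
    \<le> C * real M powr p * (\<theta> * (\<Sum>i\<in>I. P (unit_vec i)) + \<theta> powr (p / 2) * avg (signs I) P)"
  proof -
    have i1: "integrable ?L (\<lambda>t. avg (signs I) (\<lambda>\<epsilon>. disp (F t) (?v S \<epsilon>)))" for S
      by (intro integrable_avg intd)
    have i2: "integrable ?L (\<lambda>t. avg (signs I) (disp (F t)))"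
      by (intro integrable_avg[where F = "\<lambda>v t. disp (F t) v"] intd)
    have "bernoulli_avg \<theta> I (\<lambda>S. avg (signs I) (\<lambda>\<epsilon>. P (?v S \<epsilon>)))
       = (LINT t|?L. bernoulli_avg \<theta> I (\<lambda>S. avg (signs I) (\<lambda>\<epsilon>. disp (F t) (?v S \<epsilon>))))"
      by (simp only: integral_bernoulli_avg integral_avg intd i1 P)
    also have "\<dots> \<le> (LINT t|?L. C * real M powr p * (\<theta> * (\<Sum>i\<in>I. disp (F t) (unit_vec i)) + \<theta> powr (p / 2) * avg (signs I) (disp (F t))))"
    proof (rule integral_mono)
      show "bernoulli_avg \<theta> I (\<lambda>S. avg (signs I) (\<lambda>\<epsilon>. disp (F t) (?v S \<epsilon>)))
        \<le> C * real M powr p * (\<theta> * (\<Sum>i\<in>I. disp (F t) (unit_vec i)) + \<theta> powr (p / 2) * avg (signs I) (disp (F t)))" for t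
        using metric_Xp_inequality[OF per \<theta> M(3)] by (simp add: C_def Delta_def)
    qed (intro integrable_bernoulli_avg i1 integrable_mult_right Bochner_Integration.integrable_add Bochner_Integration.integrable_sum intd i2)+
    also have "\<dots> = C * real M powr p * (\<theta> * (\<Sum>i\<in>I. P (unit_vec i)) + \<theta> powr (p / 2) * avg (signs I) P)"
      using intd i2 by (simp add: P integral_avg[where F = "\<lambda>v t. disp (F t) v"] Bochner_Integration.integrable_sum)
    finally show ?thesis .
  qed
  have "P (unit_vec i) \<le> (D * s) powr p" if "i \<in> I" for i
  proof -
    have "P (unit_vec i) \<le> avg T (\<lambda>x. (D * s) powr p)"
      unfolding P_def LINT
    proof (rule avg_mono)
      fix x
      have "Lp01_dist p (f (fold_grid M n (x + unit_vec i))) (f (fold_grid M n x)) \<le> D * s * 1"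
        using lq_dist_fold_grid_unit[of M q i n x] that M q D s
        by (intro order_trans[OF upper[OF g g]] mult_left_mono) auto
      then show "Lp01_dist p (f (fold_grid M n (x + unit_vec i))) (f (fold_grid M n x)) powr p \<le> (D * s) powr p"
        using p by (intro powr_mono2) (auto simp: Lp01_dist_def)
    qed
    then show ?thesis by (simp add: avg_const)
  qed
  then have "(\<Sum>i\<in>I. P (unit_vec i)) \<le> (\<Sum>i\<in>I. (D * s) powr p)" by (rule sum_mono)
  then have upper1: "(\<Sum>i\<in>I. P (unit_vec i)) \<le> (D * s) powr p * real n" by (simp add: mult.commute)
  have upper2: "avg (signs I) P \<le> (D * s) powr p * real n powr (p / q)"
  proof -
    have "avg (signs I) P \<le> avg (signs I) (\<lambda>\<epsilon>. avg T (\<lambda>x. (D * s) powr p * real n powr (p / q)))"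
    proof (rule avg_mono)
      fix \<epsilon> :: "nat \<Rightarrow> int" assume \<epsilon>: "\<epsilon> \<in> signs I"
      show "P \<epsilon> \<le> avg T (\<lambda>x. (D * s) powr p * real n powr (p / q))"
        unfolding P_def LINT
      proof (rule avg_mono)
        fix x
        have "Lp01_dist p (f (fold_grid M n (x + \<epsilon>))) (f (fold_grid M n x)) \<le> D * s * real n powr (1 / q)"
          using lq_dist_fold_grid_sign[OF M(1) _ \<epsilon>, of q x] q D s
          by (intro order_trans[OF upper[OF g g]] mult_left_mono) auto
        then have "Lp01_dist p (f (fold_grid M n (x + \<epsilon>))) (f (fold_grid M n x)) powr p \<le> (D * s * real n powr (1 / q)) powr p"
          using p by (intro powr_mono2) (auto simp: Lp01_dist_def)
        also have "\<dots> = (D * s) powr p * real n powr (p / q)"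
          by (simp add: powr_mult powr_powr)
        finally show "Lp01_dist p (f (fold_grid M n (x + \<epsilon>))) (f (fold_grid M n x)) powr p \<le> (D * s) powr p * real n powr (p / q)" .
      qed
    qed
    then show ?thesis by (simp add: avg_const)
  qed
  \<comment> \<open>A lower bound for the mean q-th power displacement of one coordinate of
    S.\<close>
  define w where "w = (2 * real M) powr q / 4"
  define W where "W S \<epsilon> x = (\<Sum>i<n. \<bar>real_of_int (fold_int M ((x + ?v S \<epsilon>) i) - fold_int M (x i))\<bar> powr q)" for S \<epsilon> x
  have W0: "W S \<epsilon> x \<ge> 0" for S \<epsilon> x unfolding W_def by (intro sum_nonneg) auto
  have W: "real (card S) * w \<le> avg T (W S \<epsilon>)" if S: "S \<subseteq> I" and \<epsilon>: "\<epsilon> \<in> signs I" for S \<epsilon>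
  proof -
    have "real (card S) * w = (\<Sum>i\<in>S. w)" by simp
    also have "\<dots> \<le> (\<Sum>i\<in>S. avg T (\<lambda>x. \<bar>real_of_int (fold_int M ((x + ?v S \<epsilon>) i) - fold_int M (x i))\<bar> powr q))"
    proof (rule sum_mono)
      fix i assume i: "i \<in> S"
      then have iI: "i \<in> I" using S by auto
      have "(x + ?v S \<epsilon>) i = x i + 2 * int M * \<epsilon> i" for x
        using i iI by (simp add: flipv_def)
      then have "avg T (\<lambda>x. \<bar>real_of_int (fold_int M ((x + ?v S \<epsilon>) i) - fold_int M (x i))\<bar> powr q)
         = avg T (\<lambda>x. \<bar>real_of_int (fold_int M (x i + 2 * int M * \<epsilon> i) - fold_int M (x i))\<bar> powr q)"
        by (simp only:)
      \<comment> \<open>Only x i enters, so the mean over the torus is a mean over one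
        period.\<close>
      also have "\<dots> = avg {0..<8 * int M} (\<lambda>y. \<bar>real_of_int (fold_int M (y + 2 * int M * \<epsilon> i) - fold_int M y)\<bar> powr q)"
        using N iI by (subst avg_cube_resample[symmetric, where i = i]) (simp_all add: avg_const)
      finally show "w \<le> avg T (\<lambda>x. \<bar>real_of_int (fold_int M ((x + ?v S \<epsilon>) i) - fold_int M (x i))\<bar> powr q)"
        unfolding w_def using avg_fold_int_ge[OF M(1), of "\<epsilon> i" q] signsD[OF \<epsilon> iI] q by auto
    qed
    also have "\<dots> = avg T (\<lambda>x. \<Sum>i\<in>S. \<bar>real_of_int (fold_int M ((x + ?v S \<epsilon>) i) - fold_int M (x i))\<bar> powr q)"
      by (rule avg_sum[symmetric])
    also have "\<dots> \<le> avg T (W S \<epsilon>)"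
      unfolding W_def using S by (intro avg_mono sum_mono2) auto
    finally show ?thesis .
  qed
  define r where "r = p / q"
  have r: "r > 1" using q by (simp add: r_def)
  \<comment> \<open>A lower bound for the mean of W over S, \<epsilon> and x. The tangent to the
    power r at u replaces Jensen's inequality for this triple mean: it is linear in W, and its mean
    is at least u^r.\<close>
  define u where "u = \<theta> * real n * w"
  have w: "w > 0" using M by (simp add: w_def)
  have u: "u > 0" using w \<theta> by (simp add: u_def)
  have ur: "u powr (r - 1) * u = u powr r" using u by (simp add: powr_diff)
  have "s powr p * u powr r = bernoulli_avg \<theta> I (\<lambda>S. s powr p * (r * u powr (r - 1) * (real (card S) * w) - (r - 1) * u powr r))"
  proof -
    have "bernoulli_avg \<theta> I (\<lambda>S. real (card S)) = \<theta> * real n"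
      using bernoulli_avg_sum_mem[of I \<theta> "\<lambda>_. 1"] by simp
    then have "bernoulli_avg \<theta> I (\<lambda>S. (s powr p * r * u powr (r - 1) * w) * real (card S) + (- (s powr p * (r - 1) * u powr r)))
      = s powr p * r * (u powr (r - 1) * u) - s powr p * (r - 1) * u powr r"
      unfolding bernoulli_avg_add bernoulli_avg_cmult by (simp add: bernoulli_avg_const u_def)
    also have "\<dots> = s powr p * u powr r" unfolding ur by (simp add: algebra_simps)
    finally show ?thesis by (simp add: algebra_simps)
  qed
  also have "\<dots> \<le> bernoulli_avg \<theta> I (\<lambda>S. avg (signs I) (\<lambda>\<epsilon>. P (?v S \<epsilon>)))"
  proof (rule bernoulli_avg_mono)
    fix S assume S: "S \<subseteq> I"
    let ?l = "s powr p * (r * u powr (r - 1) * (real (card S) * w) - (r - 1) * u powr r)"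
    have "?l = avg (signs I) (\<lambda>\<epsilon>. ?l)" by (simp add: avg_const)
    also have "\<dots> \<le> avg (signs I) (\<lambda>\<epsilon>. P (?v S \<epsilon>))"
    proof (rule avg_mono)
      fix \<epsilon> :: "nat \<Rightarrow> int" assume \<epsilon>: "\<epsilon> \<in> signs I"
      have "?l \<le> s powr p * (r * u powr (r - 1) * avg T (W S \<epsilon>) - (r - 1) * u powr r)"
        using W[OF S \<epsilon>] r by (intro mult_left_mono diff_right_mono) auto
      also have "\<dots> = avg T (\<lambda>x. s powr p * (r * u powr (r - 1) * W S \<epsilon> x - (r - 1) * u powr r))"
        unfolding avg_cmult avg_diff by (simp add: avg_const)
      also have "\<dots> \<le> P (?v S \<epsilon>)"
        unfolding P_def LINT
      proof (rule avg_mono)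
        fix x
        have "r * u powr (r - 1) * W S \<epsilon> x - (r - 1) * u powr r \<le> W S \<epsilon> x powr r"
          using powr_tangent[OF r W0, of u S \<epsilon> x] u by (simp add: mult_ac)
        then have "s powr p * (r * u powr (r - 1) * W S \<epsilon> x - (r - 1) * u powr r) \<le> s powr p * W S \<epsilon> x powr r"
          by (intro mult_left_mono) auto
        also have "\<dots> = (s * W S \<epsilon> x powr (1 / q)) powr p"
          by (simp add: powr_mult powr_powr r_def)
        also have "\<dots> = (s * lq_dist q n (fold_grid M n (x + ?v S \<epsilon>)) (fold_grid M n x)) powr p"
          unfolding lq_dist_fold_grid[OF M(1)] W_def ..
        also have "\<dots> \<le> Lp01_dist p (f (fold_grid M n (x + ?v S \<epsilon>))) (f (fold_grid M n x)) powr p"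
          using lower[OF g g] s p by (intro powr_mono2) (auto simp: lq_dist_def)
        finally show "s powr p * (r * u powr (r - 1) * W S \<epsilon> x - (r - 1) * u powr r)
          \<le> Lp01_dist p (f (fold_grid M n (x + ?v S \<epsilon>))) (f (fold_grid M n x)) powr p" .
      qed
      finally show "?l \<le> P (?v S \<epsilon>)" .
    qed
    finally show "?l \<le> avg (signs I) (\<lambda>\<epsilon>. P (?v S \<epsilon>))" .
  qed (use \<theta> in auto)
  also have "\<dots> \<le> C * real M powr p * (\<theta> * ((D * s) powr p * real n) + \<theta> powr (p / 2) * ((D * s) powr p * real n powr (p / q)))"
    using C \<theta> by (intro order_trans[OF main] mult_left_mono add_mono upper1 upper2) auto
  also have "\<dots> = s powr p * real M powr p * (C * D powr p * (\<theta> * real n + \<theta> powr (p / 2) * real n powr (p / q)))"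
    using D s by (simp add: powr_mult algebra_simps)
  finally have "s powr p * u powr r \<le> s powr p * real M powr p * (C * D powr p * (\<theta> * real n + \<theta> powr (p / 2) * real n powr (p / q)))" .
  moreover have "u powr r \<ge> real M powr p * (\<theta> * real n) powr r"
  proof -
    \<comment> \<open>The 4^r lost by the fold is paid by the 2^p gained from the shift by 2 M; this
      works because q > 2.\<close>
    have "r \<le> p / 2" using q p by (simp add: r_def field_simps)
    then have "4 powr r \<le> (4::real) powr (p / 2)" by (intro powr_mono) auto
    also have "\<dots> = (2 powr 2) powr (p / 2)" by simp
    also have "\<dots> = 2 powr p" by (subst powr_powr) simp
    finally have "4 powr r \<le> (2::real) powr p" .
    then have "real M powr p * 4 powr r \<le> real M powr p * 2 powr p" by (intro mult_left_mono) auto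
    moreover have "w powr r = real M powr p * 2 powr p / 4 powr r"
      using q by (simp add: w_def powr_divide powr_powr r_def powr_mult)
    ultimately have "real M powr p \<le> w powr r" by (simp only: pos_le_divide_eq powr_gt_zero)
    then show ?thesis
      unfolding u_def by (subst powr_mult) (simp add: mult.commute[of "real M powr p"] mult_left_mono)
  qed
  ultimately have "(s powr p * real M powr p) * (\<theta> * real n) powr r \<le>
     (s powr p * real M powr p) * (C * D powr p * (\<theta> * real n + \<theta> powr (p / 2) * real n powr (p / q)))"
    using mult_left_mono[of "real M powr p * (\<theta> * real n) powr r" "u powr r" "s powr p"] by (simp add: mult.assoc)
  moreover have "s powr p * real M powr p > 0" using s M by simp
  ultimately have "(\<theta> * real n) powr r \<le> C * D powr p * (\<theta> * real n + \<theta> powr (p / 2) * real n powr (p / q))"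
    by (rule mult_left_le_imp_le)
  then show ?thesis by (simp add: C_def r_def)
qed

section \<open>Distortion of the grid\<close>

text \<open>The inner factor 2 counts the two terms on the right of the grid inequality, which are
  equal for the chosen \<theta>.\<close>

definition distortion_const :: "real \<Rightarrow> real" where
  "distortion_const p = (2 * (4 powr p * (Xp_const p + 2))) powr (1 / p)"

lemma distortion_const_ge_1: "p > 0 \<Longrightarrow> distortion_const p \<ge> 1"
proof -
  assume p: "p > 0"
  have "1 * 2 \<le> 4 powr p * (Xp_const p + 2)"
    using p by (intro mult_mono) (auto simp: Xp_const_def two_point_const_def ge_one_powr_ge_zero)
  then show ?thesis unfolding distortion_const_def using p by (intro ge_one_powr_ge_zero) auto
qed

lemma grid_distortion_aux:
  fixes p q s D :: real and f :: "(nat \<Rightarrow> nat) \<Rightarrow> real \<Rightarrow> real"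
  assumes q: "2 < q" "q < p" and n: "n \<ge> 1"
    and m: "8 * real n powr (1 + (p - q) / (q * (p - 2))) \<le> real m" and s: "s > 0" and D: "D \<ge> 1"
    and mem: "\<And>x. x \<in> grid m n \<Longrightarrow> Lp01_mem p (f x)"
    and lower: "\<And>x y. x \<in> grid m n \<Longrightarrow> y \<in> grid m n \<Longrightarrow> s * lq_dist q n x y \<le> Lp01_dist p (f x) (f y)"
    and upper: "\<And>x y. x \<in> grid m n \<Longrightarrow> y \<in> grid m n \<Longrightarrow> Lp01_dist p (f x) (f y) \<le> D * s * lq_dist q n x y"
  shows "real n powr ((p - q) * (q - 2) / (q\<^sup>2 * (p - 2))) \<le> distortion_const p * D"
proof -
  \<comment> \<open>\<theta> = n^(-a) equates \<theta> n and \<theta>^(p/2) n^(p/q), both being n^k.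
    As \<beta> = 1 + a / 2, n^\<beta> is n / sqrt \<theta>, the size required of M.\<close>
  define \<beta> where "\<beta> = 1 + (p - q) / (q * (p - 2))"
  define a where "a = 2 * (p - q) / (q * (p - 2))"
  define k where "k = p * (q - 2) / (q * (p - 2))"
  define \<theta> where "\<theta> = real n powr (- a)"
  define M where "M = nat \<lceil>real n powr \<beta>\<rceil>"
  define C where "C = 4 powr p * (Xp_const p + 2)"
  have p0: "p - 2 \<noteq> 0" "p \<noteq> 0" "q \<noteq> 0" using q by auto
  have C: "C > 0" unfolding C_def using q by (intro mult_pos_pos add_nonneg_pos) (auto simp: Xp_const_def two_point_const_def)
  have n1: "real n \<ge> 1" and n0: "real n > 0" using n by auto
  have a: "a \<ge> 0" using q by (simp add: a_def)
  have k: "k \<ge> 0" using q by (simp add: k_def)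
  have \<beta>: "\<beta> \<ge> 1" using q by (simp add: \<beta>_def)
  have e1: "- a + 1 = k" using p0 by (simp add: a_def k_def field_simps)
  have e2: "- a * (p / 2) + p / q = k"
  proof -
    have "- (2 * d) * (p / 2) = - (p * d)" for d :: real by simp
    from this[of "(p - q) / (q * (p - 2))"] have "- a * (p / 2) = - (p * (p - q)) / (q * (p - 2))"
      by (simp only: a_def times_divide_eq_right minus_divide_left)
    moreover have "p / q = p * (p - 2) / (q * (p - 2))" using p0 by simp
    ultimately have "- a * (p / 2) + p / q = (- (p * (p - q)) + p * (p - 2)) / (q * (p - 2))"
      by (simp only: add_divide_distrib)
    then show ?thesis by (simp add: k_def algebra_simps)
  qed
  have e3: "\<beta> - a / 2 = 1"
  proof -
    have "1 + d - 2 * d / 2 = 1" for d :: real by simp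
    from this[of "(p - q) / (q * (p - 2))"] show ?thesis by (simp only: a_def \<beta>_def times_divide_eq_right)
  qed
  \<comment> \<open>The exponent of n that is left after division by n^k and a p-th root.\<close>
  have e4: "(k * (p / q) - k) * (1 / p) = (p - q) * (q - 2) / (q\<^sup>2 * (p - 2))"
  proof -
    have "k * (p / q) - k = k * ((p - q) / q)" using p0 by (simp add: diff_divide_distrib right_diff_distrib)
    then show ?thesis using p0 by (simp add: k_def power2_eq_square mult_ac)
  qed
  have nb: "real n powr \<beta> \<ge> 1" using n1 \<beta> by (intro ge_one_powr_ge_zero) auto
  have \<theta>n: "\<theta> * real n = real n powr k"
    using n0 powr_add[of "real n" "- a" 1] unfolding e1 by (simp add: \<theta>_def)
  have \<theta>p: "\<theta> powr (p / 2) * real n powr (p / q) = real n powr k"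
    unfolding \<theta>_def powr_powr powr_add[symmetric] e2 ..
  have M1: "real M \<ge> real n powr \<beta>" "real M \<le> real n powr \<beta> + 1"
    using nb by (auto simp: M_def)
  have "(\<theta> * real n) powr (p / q) \<le> C * D powr p * (\<theta> * real n + \<theta> powr (p / 2) * real n powr (p / q))"
    unfolding C_def
  proof (rule Xp_grid[OF q _ _ _ _ _ _ s D mem lower upper])
    show "0 < \<theta>" using n0 by (simp add: \<theta>_def)
    show "\<theta> \<le> 1" unfolding \<theta>_def using n1 a powr_mono[of "- a" 0 "real n"] by simp
    show "1 \<le> \<theta> * real n" unfolding \<theta>n using n1 k by (intro ge_one_powr_ge_zero) auto
    show "M > 0" using M1 nb by linarith
    \<comment> \<open>Rounding up adds at most 1 <= n^\<beta>, so 4 M <= 8 n^\<beta>; hence the 8 in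
      the hypothesis on m.\<close>
    have "real (4 * M) \<le> real m" using m M1 nb unfolding \<beta>_def[symmetric] by simp
    then show "4 * M \<le> m" by linarith
    have "real n = real n powr \<beta> * \<theta> powr (1 / 2)"
      unfolding \<theta>_def powr_powr powr_add[symmetric] using e3 n0 by simp
    also have "\<dots> \<le> real M * \<theta> powr (1 / 2)" by (intro mult_right_mono M1) auto
    finally show "real n \<le> real M * \<theta> powr (1 / 2)" .
  qed
  then have "real n powr (k * (p / q)) \<le> (2 * C) * D powr p * real n powr k"
    unfolding \<theta>p unfolding \<theta>n powr_powr by simp
  then have "real n powr (k * (p / q) - k) \<le> (2 * C) * D powr p"
    using n0 by (simp add: powr_diff field_simps)
  then have "(real n powr (k * (p / q) - k)) powr (1 / p) \<le> ((2 * C) * D powr p) powr (1 / p)"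
    using q by (intro powr_mono2) auto
  also have "\<dots> = distortion_const p * D"
    using C D q by (simp add: powr_mult powr_powr distortion_const_def C_def)
  finally show ?thesis unfolding powr_powr e4 .
qed

lemma grid_mono: "n' \<le> n \<Longrightarrow> grid m n' \<subseteq> grid m n"
  by (auto simp: grid_def) (metis le_zero_eq linorder_not_less zero_le)

text \<open>Both points vanish beyond n', so the lower-dimensional grid sits isometrically in the
  larger one.\<close>

lemma lq_dist_grid:
  assumes "n' \<le> n" "x \<in> grid m n'" "y \<in> grid m n'"
  shows "lq_dist q n x y = lq_dist q n' x y"
proof -
  have "(\<Sum>i<n'. \<bar>real (x i) - real (y i)\<bar> powr q) = (\<Sum>i<n. \<bar>real (x i) - real (y i)\<bar> powr q)"
    using assms by (intro sum.mono_neutral_left) (auto simp: grid_def)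
  then show ?thesis by (simp add: lq_dist_def)
qed

text \<open>When m is too small for dimension n, the embedding is restricted to a subgrid of
  dimension n' of order \<mu> / 8, for which the side m suffices. As the exponent e is at most 1,
  passing from n' back to \<mu> costs a factor of at most 16.\<close>

lemma grid_distortion:
  fixes p q s D :: real and f :: "(nat \<Rightarrow> nat) \<Rightarrow> real \<Rightarrow> real"
  assumes q: "2 < q" "q < p" and s: "s > 0" and D: "D \<ge> 1"
    and mem: "\<And>x. x \<in> grid m n \<Longrightarrow> Lp01_mem p (f x)"
    and lower: "\<And>x y. x \<in> grid m n \<Longrightarrow> y \<in> grid m n \<Longrightarrow> s * lq_dist q n x y \<le> Lp01_dist p (f x) (f y)"
    and upper: "\<And>x y. x \<in> grid m n \<Longrightarrow> y \<in> grid m n \<Longrightarrow> Lp01_dist p (f x) (f y) \<le> D * s * lq_dist q n x y"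
  shows "min (real m powr (q * (p - 2) / (q * (p - 2) + p - q))) (real n) powr ((p - q) * (q - 2) / (q\<^sup>2 * (p - 2)))
    \<le> 16 * distortion_const p * D"
proof -
  define \<beta> where "\<beta> = 1 + (p - q) / (q * (p - 2))"
  define e where "e = (p - q) * (q - 2) / (q\<^sup>2 * (p - 2))"
  define \<mu> where "\<mu> = min (real m powr (q * (p - 2) / (q * (p - 2) + p - q))) (real n)"
  have \<beta>: "\<beta> \<ge> 1" using q by (simp add: \<beta>_def)
  have \<beta>_inv: "q * (p - 2) / (q * (p - 2) + p - q) = 1 / \<beta>"
    using q by (simp add: \<beta>_def add_divide_eq_iff add_diff_eq)
  have Dc: "distortion_const p \<ge> 1" using q by (intro distortion_const_ge_1) auto
  have e: "0 \<le> e" "e \<le> 1"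
  proof -
    show "0 \<le> e" unfolding e_def using q by (intro divide_nonneg_nonneg mult_nonneg_nonneg) auto
    have "q - 2 \<le> q\<^sup>2" using q self_le_power[of q 2] by linarith
    then have "(p - q) * (q - 2) \<le> (p - 2) * q\<^sup>2" using q by (intro mult_mono) auto
    then show "e \<le> 1" unfolding e_def using q by (simp add: mult.commute)
  qed
  have \<mu>: "0 \<le> \<mu>" by (simp add: \<mu>_def)
  have "\<mu> powr e \<le> 16 * distortion_const p * D"
  \<comment> \<open>For \<mu> <= 8 the bound is trivial, because D and the constant are at least 1;
    otherwise \<mu> / 8 has a positive integer part.\<close>
  proof (cases "\<mu> \<le> 8")
    case True
    then have "\<mu> powr e \<le> 8 powr e" using \<mu> e by (intro powr_mono2) auto
    also have "\<dots> \<le> 8 powr 1" using e by (intro powr_mono) auto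
    also have "\<dots> \<le> 16 * (1 * 1)" by simp
    also have "\<dots> \<le> 16 * (distortion_const p * D)" using Dc D by (intro mult_left_mono mult_mono) auto
    finally show ?thesis by simp
  next
    case False
    define n' where "n' = nat \<lfloor>\<mu> / 8\<rfloor>"
    have n': "n' \<ge> 1" "real n' \<le> \<mu> / 8" "\<mu> \<le> 16 * real n'"
    proof -
      have f: "real n' = real_of_int \<lfloor>\<mu> / 8\<rfloor>" "\<lfloor>\<mu> / 8\<rfloor> \<ge> 1" using False by (auto simp: n'_def)
      then have "real n' \<ge> 1" by linarith
      then show "n' \<ge> 1" by linarith
      show "real n' \<le> \<mu> / 8" unfolding f by linarith
      \<comment> \<open>Rounding down a number that is at least 1 loses less than a factor 2, so 8
        becomes 16.\<close>
      show "\<mu> \<le> 16 * real n'" using f(2) unfolding f(1) by linarith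
    qed
    have "\<mu> \<le> real n" by (simp add: \<mu>_def)
    then have nn: "n' \<le> n" using n'(2) \<mu> by linarith
    have mpos: "real m > 0" using False by (cases "m = 0") (auto simp: \<mu>_def)
    have "8 * real n' powr \<beta> \<le> 8 * (\<mu> / 8) powr \<beta>"
      using n' \<beta> by (intro mult_left_mono powr_mono2) auto
    also have "\<dots> = 8 / 8 powr \<beta> * \<mu> powr \<beta>" by (simp add: powr_divide)
    \<comment> \<open>Because \<beta> >= 1, dividing \<mu> by 8 pays for the factor 8 in the
      hypothesis on m.\<close>
    also have "\<dots> \<le> 1 * \<mu> powr \<beta>"
      using powr_mono[OF \<beta>, of 8] by (intro mult_right_mono) auto
    also have "\<dots> \<le> 1 * (real m powr (1 / \<beta>)) powr \<beta>"
      using \<mu> \<beta> unfolding \<beta>_inv[symmetric] by (intro mult_left_mono powr_mono2) (auto simp: \<mu>_def)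
    also have "\<dots> = real m" using \<beta> mpos by (simp add: powr_powr)
    finally have m: "8 * real n' powr \<beta> \<le> real m" .
    have "real n' powr e \<le> distortion_const p * D"
      unfolding e_def
    proof (rule grid_distortion_aux[OF q n'(1) m[unfolded \<beta>_def] s D])
      fix x y assume x: "x \<in> grid m n'" 
      then have x': "x \<in> grid m n" using grid_mono[OF nn] by auto
      then show "Lp01_mem p (f x)" by (rule mem)
      assume y: "y \<in> grid m n'" 
      then have y': "y \<in> grid m n" using grid_mono[OF nn] by auto
      show "s * lq_dist q n' x y \<le> Lp01_dist p (f x) (f y)"
        using lower[OF x' y'] lq_dist_grid[OF nn x y] by simp
      show "Lp01_dist p (f x) (f y) \<le> D * s * lq_dist q n' x y"
        using upper[OF x' y'] lq_dist_grid[OF nn x y] by simp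
    qed
    moreover have "\<mu> powr e \<le> (16 * real n') powr e" using \<mu> e n' by (intro powr_mono2) auto
    moreover have "(16 * real n') powr e = 16 powr e * real n' powr e" by (simp add: powr_mult)
    moreover have "16 powr e * real n' powr e \<le> 16 powr 1 * (distortion_const p * D)"
      using e calculation(1) by (intro mult_mono powr_mono) auto
    ultimately show ?thesis by simp
  qed
  then show ?thesis by (simp add: \<mu>_def e_def)
qed

lemma c_p_grid_ge:
  fixes p q :: real
  assumes q: "2 < q" "q < p"
  shows "c_p p (grid m n) (lq_dist q n) \<ge>
    ereal (1 / (16 * distortion_const p) * (min (real m powr (q * (p - 2) / (q * (p - 2) + p - q))) (real n))
                        powr ((p - q) * (q - 2) / (q\<^sup>2 * (p - 2))))"
  unfolding c_p_def
proof (rule Inf_greatest)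
  fix z assume "z \<in> {ereal D | D. D \<ge> 1 \<and>
     (\<exists>s>0. \<exists>f :: (nat \<Rightarrow> nat) \<Rightarrow> real \<Rightarrow> real. (\<forall>x\<in>grid m n. Lp01_mem p (f x)) \<and>
        (\<forall>x\<in>grid m n. \<forall>y\<in>grid m n. s * lq_dist q n x y \<le> Lp01_dist p (f x) (f y) \<and>
                        Lp01_dist p (f x) (f y) \<le> D * s * lq_dist q n x y))}"
  then obtain D s and f :: "(nat \<Rightarrow> nat) \<Rightarrow> real \<Rightarrow> real" where z: "z = ereal D" and D: "D \<ge> 1" and s: "s > 0"
    and f: "\<forall>x\<in>grid m n. Lp01_mem p (f x)" "\<forall>x\<in>grid m n. \<forall>y\<in>grid m n. s * lq_dist q n x y \<le> Lp01_dist p (f x) (f y) \<and>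
                        Lp01_dist p (f x) (f y) \<le> D * s * lq_dist q n x y"
    by blast
  have "distortion_const p \<ge> 1" using q by (intro distortion_const_ge_1) auto
  then show "ereal (1 / (16 * distortion_const p) * (min (real m powr (q * (p - 2) / (q * (p - 2) + p - q))) (real n))
                        powr ((p - q) * (q - 2) / (q\<^sup>2 * (p - 2)))) \<le> z"
    using grid_distortion[OF q s D, of m n f] f unfolding z by (simp add: field_simps)
qed

theorem mainTheorem5:
  shows "\<exists>C::real. C > 0 \<and> (\<forall>p::real. p > 2 \<longrightarrow>
    (\<exists>\<alpha>::real. \<alpha> > 0 \<and> (\<forall>q::real. \<forall>m n :: nat. 2 < q \<and> q < p \<longrightarrow>
       c_p p (grid m n) (lq_dist q n) \<ge>
       ereal (C * \<alpha> * (min (real m powr (q * (p - 2) / (q * (p - 2) + p - q))) (real n))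
                        powr ((p - q) * (q - 2) / (q\<^sup>2 * (p - 2)))))) \<and>
    (\<exists>\<alpha>::real. \<alpha> > 0 \<and> (\<forall>q::real. \<forall>m n :: nat. 2 < q \<and> q < p \<and>
        real m \<ge> real n powr (1 + (p - q) / (q * (p - 2))) \<longrightarrow>
       c_p p (grid m n) (lq_dist q n) \<ge>
       ereal (\<alpha> * real n powr ((p - q) * (q - 2) / (q\<^sup>2 * (p - 2)))))))"
\<comment> \<open>The universal constant can be 1, since \<alpha> may depend on p and absorbs the
  rest.\<close>
proof (rule exI[of _ 1], intro conjI allI impI)
  fix p :: real assume p: "p > 2"
  let ?\<alpha> = "1 / (16 * distortion_const p)"
  have \<alpha>: "?\<alpha> > 0" using distortion_const_ge_1[of p] p by simp
  show "\<exists>\<alpha>::real. \<alpha> > 0 \<and> (\<forall>q::real. \<forall>m n :: nat. 2 < q \<and> q < p \<longrightarrow>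
       c_p p (grid m n) (lq_dist q n) \<ge>
       ereal (1 * \<alpha> * (min (real m powr (q * (p - 2) / (q * (p - 2) + p - q))) (real n))
                        powr ((p - q) * (q - 2) / (q\<^sup>2 * (p - 2)))))"
  proof (intro exI[of _ ?\<alpha>] conjI allI impI \<alpha>)
    fix q :: real and m n :: nat assume "2 < q \<and> q < p"
    then show "c_p p (grid m n) (lq_dist q n) \<ge>
       ereal (1 * ?\<alpha> * (min (real m powr (q * (p - 2) / (q * (p - 2) + p - q))) (real n))
                        powr ((p - q) * (q - 2) / (q\<^sup>2 * (p - 2))))"
      using c_p_grid_ge[of q p] unfolding mult_1 by blast
  qed
  show "\<exists>\<alpha>::real. \<alpha> > 0 \<and> (\<forall>q::real. \<forall>m n :: nat. 2 < q \<and> q < p \<and>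
        real m \<ge> real n powr (1 + (p - q) / (q * (p - 2))) \<longrightarrow>
       c_p p (grid m n) (lq_dist q n) \<ge>
       ereal (\<alpha> * real n powr ((p - q) * (q - 2) / (q\<^sup>2 * (p - 2)))))"
  proof (intro exI[of _ ?\<alpha>] conjI allI impI \<alpha>)
    fix q :: real and m n :: nat
    assume a: "2 < q \<and> q < p \<and> real m \<ge> real n powr (1 + (p - q) / (q * (p - 2)))"
    let ?\<beta> = "1 + (p - q) / (q * (p - 2))"
    have \<beta>: "?\<beta> > 0" using a by (intro add_pos_nonneg divide_nonneg_nonneg) auto
    have \<beta>_inv: "q * (p - 2) / (q * (p - 2) + p - q) = 1 / ?\<beta>"
      using a by (simp add: add_divide_eq_iff add_diff_eq)
    \<comment> \<open>The hypothesis on m is n^\<beta> <= m, and a root of order \<beta> shows that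
      the minimum is n.\<close>
    have "real n = (real n powr ?\<beta>) powr (1 / ?\<beta>)" using \<beta> by (simp add: powr_powr)
    also have "\<dots> \<le> real m powr (1 / ?\<beta>)" using a \<beta> by (intro powr_mono2) auto
    finally have "min (real m powr (q * (p - 2) / (q * (p - 2) + p - q))) (real n) = real n"
      unfolding \<beta>_inv by simp
    then show "c_p p (grid m n) (lq_dist q n) \<ge> ereal (?\<alpha> * real n powr ((p - q) * (q - 2) / (q\<^sup>2 * (p - 2))))"
      using c_p_grid_ge[of q p m n] a by simp
  qed
qed simp

end
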